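(* Let $\alpha=\alpha_1\cdots\alpha_R$ be a composition with $\alpha\neq(1^R)$, let $i$ be minimal with $\alpha_i\ge2$, and let $i<j\le R$ and $1\le t\le\alpha_i-1$. Then $$r_\alpha-r_{M_{j,t}(\alpha)}=\sum_{T\in A_{j,t}(\alpha)}s_{\mathrm{cont}(T)}-\sum_{U\in B_{j,t}(\alpha)}s_{\mathrm{cont}(U)}.$$
   Context: Ribbon diagram of a composition $\gamma=\gamma_1\cdots\gamma_R$ (English convention, rows numbered from top): $\gamma_i$ cells in row $i$, the rightmost cell of row $i+1$ directly below the leftmost cell of row $i$; $U_{r,c}$ denotes the entry in row $r$, column $c$. A semistandard Young tableau (SSYT) of ribbon shape $\gamma$ is a filling by positive integers weakly increasing along rows and strictly increasing down columns; $\mathrm{cont}(T)=c_1c_2\cdots$ where $c_m$ is the number of $m$'s; $r_\gamma=\sum_T\prod_m x_m^{c_m}$ over such $T$, and $s_\mu$ is the Schur function. A Littlewood--Richardson (LR) tableau of shape $\gamma$ is an SSYT of ribbon shape $\gamma$ whose reading word (entries read right to left within each row, rows from top to bottom) is a lattice word: every initial segment contains at least as many $m$'s as $(m+1)$'s for all $m\ge1$ (so its content is a partition). With $i,j,t$ as in the claim: $M_{j,t}(\alpha)$ is the composition obtained from $\alpha$ by replacing $\alpha_i$ with $\alpha_i-t$ and $\alpha_j$ with $\alpha_j+t$. $A_{j,t}(\alpha)$ is the set of LR tableaux $T$ of shape $\alpha$ such that for some $j'$ with $i\le j'\le j-1$, the number of $1$'s in the first $j'$ rows of $T$ minus the number of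 $2$'s in the first $j'+1$ rows of $T$ is less than $t$. $B_{j,t}(\alpha)$ is the set of LR tableaux $U$ of shape $M_{j,t}(\alpha)$ such that, letting $j_1$ be the column of the leftmost cell of row $j$ of $U$: if $U_{j,j_1}=\cdots=U_{j,j_1+t-1}=1$, then $j\le R-1$ and $U_{j,j_1+t}\ge U_{j+1,j_1}$. *)

theory Defs
  imports Main "HOL-Library.Function_Algebras"
begin

text \<open>
  Rows, columns and parts are numbered from 1.  A composition is a list of positive numbers, and
  \<open>part \<gamma> k\<close> is meant for \<open>1 \<le> k \<le> length \<gamma>\<close> only.
\<close>

definition part :: "nat list \<Rightarrow> nat \<Rightarrow> nat" where
  "part \<gamma> k = \<gamma> ! (k - 1)"

text \<open>
  Column of the leftmost cell of row \<open>r\<close> of the ribbon of \<open>\<gamma>\<close>.  The last row starts in column 1.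
  The rightmost cell of row \<open>r + 1\<close> lies below the leftmost cell of row \<open>r\<close>, so each row \<open>k > r\<close>
  moves row \<open>r\<close> to the right by \<open>\<gamma>\<^sub>k - 1\<close>.
\<close>

definition leftcol :: "nat list \<Rightarrow> nat \<Rightarrow> nat" where
  "leftcol \<gamma> r = 1 + (\<Sum>k\<in>{r<..length \<gamma>}. part \<gamma> k - 1)"

definition ribbon :: "nat list \<Rightarrow> (nat \<times> nat) set" where
  "ribbon \<gamma> = {(r, c). 1 \<le> r \<and> r \<le> length \<gamma> \<and> leftcol \<gamma> r \<le> c \<and> c < leftcol \<gamma> r + part \<gamma> r}"

lemma ribbon_overlap:
  assumes "\<forall>a\<in>set \<gamma>. 0 < a" and "1 \<le> r" and "r < length \<gamma>"
  shows "leftcol \<gamma> (Suc r) + part \<gamma> (Suc r) - 1 = leftcol \<gamma> r"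
proof -
  have "{r<..length \<gamma>} = insert (Suc r) {Suc r<..length \<gamma>}"
    using assms(3) by auto
  moreover have "0 < part \<gamma> (Suc r)"
    using assms by (simp add: part_def)
  ultimately show ?thesis
    by (simp add: leftcol_def)
qed

definition young_diagram :: "(nat \<Rightarrow> nat) \<Rightarrow> (nat \<times> nat) set" where
  "young_diagram \<mu> = {(r, c). 1 \<le> r \<and> 1 \<le> c \<and> c \<le> \<mu> r}"

text \<open>
  A filling of a diagram \<open>D\<close> is a function \<open>T\<close> with \<open>T r c\<close> the entry in row \<open>r\<close> and column \<open>c\<close>.
  It takes the value 0 exactly outside \<open>D\<close>, so that distinct functions are distinct fillings.
\<close>

definition ssyt :: "(nat \<times> nat) set \<Rightarrow> (nat \<Rightarrow> nat \<Rightarrow> nat) set" where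
  "ssyt D = {T.
     (\<forall>r c. (r, c) \<in> D \<longleftrightarrow> 1 \<le> T r c) \<and>
     (\<forall>r c c'. (r, c) \<in> D \<and> (r, c') \<in> D \<and> c < c' \<longrightarrow> T r c \<le> T r c') \<and>
     (\<forall>r r' c. (r, c) \<in> D \<and> (r', c) \<in> D \<and> r < r' \<longrightarrow> T r c < T r' c)}"

text \<open>
  The content \<open>c\<^sub>1 c\<^sub>2 \<dots>\<close> of a filling.  The value 0 marks positions outside the diagram and is not
  counted.
\<close>

definition cont :: "(nat \<Rightarrow> nat \<Rightarrow> nat) \<Rightarrow> nat \<Rightarrow> nat" where
  "cont T m = (if m = 0 then 0 else card {(r, c). T r c = m})"

text \<open>
  A formal power series in \<open>x\<^sub>1, x\<^sub>2, \<dots>\<close> with integer coefficients is represented by its coefficient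
  function: \<open>f e\<close> is the coefficient of the product of the \<open>x\<^sub>m\<close> to the power \<open>e m\<close>, and addition is
  pointwise.  All series below vanish at exponent functions with infinite support and at those with
  \<open>e 0 \<noteq> 0\<close>.  The coefficient at \<open>e\<close> of the sum of the monomials of all semistandard tableaux is the
  (finite) number of tableaux with content \<open>e\<close>.
\<close>

type_synonym series = "(nat \<Rightarrow> nat) \<Rightarrow> int"

definition tableau_series :: "(nat \<times> nat) set \<Rightarrow> series" where
  "tableau_series D = (\<lambda>e. int (card {T \<in> ssyt D. cont T = e}))"

definition ribbon_schur :: "nat list \<Rightarrow> series" where
  "ribbon_schur \<gamma> = tableau_series (ribbon \<gamma>)"

definition schur :: "(nat \<Rightarrow> nat) \<Rightarrow> series" where
  "schur \<mu> = tableau_series (young_diagram \<mu>)"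

definition reading_word :: "nat list \<Rightarrow> (nat \<Rightarrow> nat \<Rightarrow> nat) \<Rightarrow> nat list" where
  "reading_word \<gamma> T =
     concat (map (\<lambda>r. rev (map (T r) [leftcol \<gamma> r..<leftcol \<gamma> r + part \<gamma> r])) [1..<Suc (length \<gamma>)])"

definition lattice_word :: "nat list \<Rightarrow> bool" where
  "lattice_word w \<longleftrightarrow>
     (\<forall>n \<le> length w. \<forall>m \<ge> 1. count_list (take n w) (m + 1) \<le> count_list (take n w) m)"

definition lr_tableaux :: "nat list \<Rightarrow> (nat \<Rightarrow> nat \<Rightarrow> nat) set" where
  "lr_tableaux \<gamma> = {T \<in> ssyt (ribbon \<gamma>). lattice_word (reading_word \<gamma> T)}"

definition count_rows :: "(nat \<Rightarrow> nat \<Rightarrow> nat) \<Rightarrow> nat \<Rightarrow> nat \<Rightarrow> nat" where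
  "count_rows T k m = card {(r, c). r \<le> k \<and> T r c = m}"

definition move_cells :: "nat \<Rightarrow> nat \<Rightarrow> nat \<Rightarrow> nat list \<Rightarrow> nat list" where
  "move_cells i j t \<alpha> = \<alpha>[i - 1 := part \<alpha> i - t, j - 1 := part \<alpha> j + t]"

definition A_set :: "nat \<Rightarrow> nat \<Rightarrow> nat \<Rightarrow> nat list \<Rightarrow> (nat \<Rightarrow> nat \<Rightarrow> nat) set" where
  "A_set i j t \<alpha> = {T \<in> lr_tableaux \<alpha>.
     \<exists>j'. i \<le> j' \<and> j' \<le> j - 1 \<and> int (count_rows T j' 1) - int (count_rows T (j' + 1) 2) < int t}"

definition B_set :: "nat \<Rightarrow> nat \<Rightarrow> nat \<Rightarrow> nat list \<Rightarrow> (nat \<Rightarrow> nat \<Rightarrow> nat) set" where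
  "B_set i j t \<alpha> = {U \<in> lr_tableaux (move_cells i j t \<alpha>).
     let j1 = leftcol (move_cells i j t \<alpha>) j in
       (\<forall>c. j1 \<le> c \<and> c \<le> j1 + t - 1 \<longrightarrow> U j c = 1) \<longrightarrow>
       j \<le> length \<alpha> - 1 \<and> U j (j1 + t) \<ge> U (j + 1) j1}"

end

theory Submission
  imports "HOL-Library.Multiset" Defs
begin

text \<open>
  The ribbon case of the Littlewood--Richardson rule reduces the claim to a bijection between the LR
  tableaux of shape \<open>\<alpha>\<close> outside \<open>A\<close> and those of shape \<open>M\<^sub>j\<^sub>,\<^sub>t(\<alpha>)\<close> outside \<open>B\<close>. As rows \<open>1, \<dots>, i - 1\<close>
  are single cells, row \<open>i\<close> of an LR tableau is \<open>1 \<dots> 1 i\<close>; the bijection moves \<open>t\<close> of these ones to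
  the left end of row \<open>j\<close>. Because all \<open>m + 1\<close> are read before the \<open>m\<close> of the same row, the lattice
  condition says that rows \<open>1, \<dots>, k + 1\<close> contain at most as many \<open>m + 1\<close> as rows \<open>1, \<dots>, k\<close> contain
  \<open>m\<close>. So the move spoils it only for \<open>m = 1\<close> and \<open>i \<le> k < j\<close>, which is what \<open>A\<close> measures, and it can
  be undone unless the new row \<open>j\<close> does not start with \<open>t\<close> ones or its next entry conflicts with row
  \<open>j + 1\<close>, which is \<open>B\<close>.

  For the LR rule, say that a set \<open>X\<close> of words expands if, for all partitions \<open>\<mu>\<close>, the product of
  \<open>s\<^sub>\<mu>\<close> with the generating function of \<open>X\<close> is the sum of \<open>s\<close> at \<open>\<mu>\<close> plus the content of \<open>w\<close>, over
  the \<open>w\<close> in \<open>X\<close> that are lattice words relative to \<open>\<mu>\<close>. For weakly decreasing words of length \<open>n\<close>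
  this is Pieri's rule. The property passes to concatenations of word sets and to differences, and the
  reading words of the ribbon \<open>a b \<gamma>\<close> are all concatenations of a decreasing word of length \<open>a\<close> and a
  reading word of \<open>b \<gamma>\<close>, except those that are reading words of the ribbon \<open>(a + b) \<gamma>\<close>. Pieri's rule
  itself follows by removing the largest letter from the tableaux, from Fomin's local rule for
  adding and removing horizontal strips.
\<close>

subsection \<open>Horizontal strips and the local rule\<close>

text \<open>Partitions, contents and exponents share one type that includes index 0; the value there
  is pinned to 0, as in \<open>cont\<close>, and the decrease starts at index 1.\<close>

definition is_partition :: "(nat \<Rightarrow> nat) \<Rightarrow> bool" where
  "is_partition \<mu> \<longleftrightarrow> \<mu> 0 = 0 \<and> (\<forall>m\<ge>1. \<mu> (Suc m) \<le> \<mu> m) \<and> finite {m. \<mu> m \<noteq> 0}"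

definition size_fun :: "(nat \<Rightarrow> nat) \<Rightarrow> nat" where
  "size_fun f = (\<Sum>m | f m \<noteq> 0. f m)"

text \<open>The interlacing \<open>\<rho> 1 \<ge> \<mu> 1 \<ge> \<rho> 2 \<ge> \<mu> 2 \<ge>
  \<dots>\<close> says that the skew shape \<rho>/\<mu> has at most one cell in each column.\<close>

definition horizontal_strip :: "(nat \<Rightarrow> nat) \<Rightarrow> (nat \<Rightarrow> nat) \<Rightarrow> bool" where
  "horizontal_strip \<mu> \<rho> \<longleftrightarrow> is_partition \<mu> \<and> is_partition \<rho> \<and>
     (\<forall>m\<ge>1. \<mu> m \<le> \<rho> m \<and> \<rho> (Suc m) \<le> \<mu> m)"

text \<open>A Kostka number, for any exponent function \<open>e\<close>: the coefficient at
  \<open>e\<close> of the Schur function of \<rho>, kept in the naturals.\<close>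

definition kostka :: "(nat \<Rightarrow> nat) \<Rightarrow> (nat \<Rightarrow> nat) \<Rightarrow> nat" where
  "kostka \<rho> e = card {T \<in> ssyt (young_diagram \<rho>). cont T = e}"

lemma finite_support_bound:
  assumes "finite {m::nat. f m \<noteq> (0::nat)}"
  obtains L where "\<And>m. L < m \<Longrightarrow> f m = 0"
proof -
  obtain L where "\<forall>m\<in>{m. f m \<noteq> 0}. m \<le> L"
    using assms unfolding finite_nat_set_iff_bounded_le by blast
  then show thesis
    by (intro that[of L]) (metis mem_Collect_eq not_le)
qed

lemma size_fun_eq:
  assumes "\<And>m. L < m \<Longrightarrow> f m = 0"
  shows "size_fun f = sum f {..L}"
  unfolding size_fun_def
proof (rule sum.mono_neutral_left)
  show "{m. f m \<noteq> 0} \<subseteq> {..L}"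
    using assms by (metis (mono_tags) atMost_iff mem_Collect_eq not_le subsetI)
qed auto

lemma size_fun_add:
  assumes "finite {m. f m \<noteq> 0}" "finite {m. g m \<noteq> 0}"
  shows "size_fun (f + g) = size_fun f + size_fun g"
proof -
  obtain L where L: "\<And>m. L < m \<Longrightarrow> f m = 0"
    using assms(1) finite_support_bound by blast
  obtain M where M: "\<And>m. M < m \<Longrightarrow> g m = 0"
    using assms(2) finite_support_bound by blast
  show ?thesis
    using L M by (simp add: size_fun_eq[of "max L M"] sum.distrib)
qed

lemma size_fun_0: "size_fun 0 = 0"
  by (simp add: size_fun_def)

lemma finite_support_le:
  fixes f g :: "nat \<Rightarrow> nat"
  assumes "f \<le> g" "finite {m. g m \<noteq> 0}"
  shows "finite {m. f m \<noteq> 0}"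
proof (rule finite_subset[OF _ assms(2)])
  show "{m. f m \<noteq> 0} \<subseteq> {m. g m \<noteq> 0}"
    using assms(1) by (metis (mono_tags, lifting) Collect_mono le_fun_def le_zero_eq)
qed

lemma finite_functions_le:
  fixes g :: "nat \<Rightarrow> nat"
  assumes "finite {m. g m \<noteq> 0}"
  shows "finite {f. f \<le> g}"
proof -
  obtain L where L: "\<And>m. L < m \<Longrightarrow> g m = 0"
    using assms finite_support_bound by blast
  have "f m \<le> sum g {..L}" if "f \<le> g" "m \<le> L" for f m
    by (rule order_trans[of _ "g m"]) (use that in \<open>auto simp: le_fun_def member_le_sum\<close>)
  moreover have "f m = 0" if "f \<le> g" "\<not> m \<le> L" for f m
    using that L[of m] by (metis le_fun_def le_zero_eq not_le)
  ultimately have "{f. f \<le> g} \<subseteq> {f. \<forall>x. (x \<in> {..L} \<longrightarrow> f x \<in> {..sum g {..L}}) \<and> (x \<notin> {..L} \<longrightarrow> f x = 0)}"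
    by auto
  then show ?thesis
    by (rule finite_subset) (intro finite_set_of_finite_funs, auto)
qed

lemma horizontal_strip_le: "horizontal_strip \<mu> \<rho> \<Longrightarrow> \<mu> \<le> \<rho>"
  unfolding le_fun_def
proof
  fix m assume "horizontal_strip \<mu> \<rho>"
  then show "\<mu> m \<le> \<rho> m"
    by (cases m) (auto simp: horizontal_strip_def is_partition_def)
qed

lemma size_fun_mono:
  assumes "f \<le> g" "finite {m. g m \<noteq> 0}"
  shows "size_fun f \<le> size_fun g"
proof -
  obtain L where L: "\<And>m. L < m \<Longrightarrow> g m = 0"
    using assms(2) finite_support_bound by blast
  then have "\<And>m. L < m \<Longrightarrow> f m = 0"
    using assms(1) by (metis le_fun_def le_zero_eq)
  then show ?thesis
    using L assms(1) by (simp add: size_fun_eq[of L] sum_mono le_fun_def)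
qed

lemma finite_strips_below: "finite {\<mu>. horizontal_strip \<mu> \<rho>}"
proof (cases "is_partition \<rho>")
  case True
  show ?thesis
    by (rule finite_subset[OF _ finite_functions_le[of \<rho>]])
      (use True in \<open>auto simp: horizontal_strip_le is_partition_def\<close>)
qed (simp add: horizontal_strip_def)

text \<open>No part shrinks, so the first part grows by no more than the whole size does. This
  bounds the one part that interlacing leaves free in \<open>finite_strips_above\<close>.\<close>

lemma horizontal_strip_first:
  assumes "horizontal_strip \<mu> \<rho>"
  shows "\<mu> 1 \<le> \<rho> 1" "\<rho> 1 + size_fun \<mu> \<le> size_fun \<rho> + \<mu> 1"
proof -
  show "\<mu> 1 \<le> \<rho> 1"
    using assms by (simp add: horizontal_strip_def)
  obtain L where L: "\<And>m. L < m \<Longrightarrow> \<rho> m = 0"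
    using assms finite_support_bound unfolding horizontal_strip_def is_partition_def by metis
  have *: "size_fun f = f 1 + sum f ({..Suc L} - {1})" if "f \<le> \<rho>" for f
  proof -
    have "size_fun f = sum f {..Suc L}"
      by (rule size_fun_eq) (use that L in \<open>metis Suc_lessD le_fun_def le_zero_eq\<close>)
    then show ?thesis
      by (subst (asm) sum.remove[of _ 1]) auto
  qed
  have "sum \<mu> ({..Suc L} - {1}) \<le> sum \<rho> ({..Suc L} - {1})"
    by (rule sum_mono) (use horizontal_strip_le[OF assms] in \<open>simp add: le_fun_def\<close>)
  then show "\<rho> 1 + size_fun \<mu> \<le> size_fun \<rho> + \<mu> 1"
    using *[OF horizontal_strip_le[OF assms]] *[of \<rho>] by simp
qed

lemma finite_strips_above: "finite {\<rho>. horizontal_strip \<mu> \<rho> \<and> size_fun \<rho> = n}"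
proof (cases "is_partition \<mu>")
  case True
  \<comment> \<open>Interlacing bounds each later part of \<rho> by the preceding part of \<mu>;
    only for part 1 is the size \<open>n\<close> needed.\<close>
  let ?g = "\<lambda>m. if m = 1 then \<mu> 1 + n else \<mu> (m - 1)"
  have "\<rho> \<le> ?g" if "horizontal_strip \<mu> \<rho>" "size_fun \<rho> = n" for \<rho>
  proof (rule le_funI)
    fix m
    consider "m = 0" | "m = 1" | k where "m = Suc k" "k \<ge> 1"
      by (metis One_nat_def Suc_leI gr0I not0_implies_Suc)
    then show "\<rho> m \<le> ?g m"
    proof cases
      case 2
      then show ?thesis
        using horizontal_strip_first[OF that(1)] size_fun_mono[OF horizontal_strip_le[OF that(1)]] that
        by (simp add: horizontal_strip_def is_partition_def)
    qed (use that in \<open>auto simp: horizontal_strip_def is_partition_def\<close>)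
  qed
  moreover have "finite {m. ?g m \<noteq> 0}"
  proof (rule finite_subset)
    show "{m. ?g m \<noteq> 0} \<subseteq> insert 0 (insert 1 (Suc ` {m. \<mu> m \<noteq> 0}))"
    proof
      fix m assume "m \<in> {m. ?g m \<noteq> 0}"
      then show "m \<in> insert 0 (insert 1 (Suc ` {m. \<mu> m \<noteq> 0}))"
        by (cases m) (auto split: if_splits)
    qed
  qed (use True in \<open>simp add: is_partition_def\<close>)
  ultimately show ?thesis
    by (intro finite_subset[OF _ finite_functions_le[of ?g]]) auto
qed (simp add: horizontal_strip_def)

text \<open>
  Given horizontal strips on partitions \<open>\<mu>\<close> and \<open>\<nu>\<close>, the part \<open>m\<close> of a common lower bound and the part
  \<open>m + 1\<close> of a common upper bound range over the same interval, from \<open>max (\<mu> (m + 1)) (\<nu> (m + 1))\<close> to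
  \<open>min (\<mu> m) (\<nu> m)\<close>. Reflecting this interval exchanges the two; the first part of the upper bound is
  unbounded and accounts for the extra number \<open>k\<close>.
\<close>

definition reflection :: "(nat \<Rightarrow> nat) \<Rightarrow> (nat \<Rightarrow> nat) \<Rightarrow> nat \<Rightarrow> nat" where
  "reflection \<mu> \<nu> m = max (\<mu> (Suc m)) (\<nu> (Suc m)) + min (\<mu> m) (\<nu> m)"

definition lower_corner :: "(nat \<Rightarrow> nat) \<Rightarrow> (nat \<Rightarrow> nat) \<Rightarrow> (nat \<Rightarrow> nat) \<Rightarrow> nat \<Rightarrow> nat" where
  "lower_corner \<mu> \<nu> \<rho> m = (if m = 0 then 0 else reflection \<mu> \<nu> m - \<rho> (Suc m))"

definition upper_corner :: "(nat \<Rightarrow> nat) \<Rightarrow> (nat \<Rightarrow> nat) \<Rightarrow> nat \<Rightarrow> (nat \<Rightarrow> nat) \<Rightarrow> nat \<Rightarrow> nat" where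
  "upper_corner \<mu> \<nu> k \<kappa> m = (if m = 0 then 0 else if m = 1 then max (\<mu> 1) (\<nu> 1) + k
     else reflection \<mu> \<nu> (m - 1) - \<kappa> (m - 1))"

text \<open>Summed over all \<open>m\<close>, the reflections and the first part of \<rho> give
  \<open>k\<close> plus the sizes of the pointwise maximum and minimum of \<mu> and \<nu>, and
  maximum and minimum add up to \<open>\<mu> + \<nu>\<close>.\<close>

lemma corner_size:
  assumes "is_partition \<mu>" "is_partition \<nu>" "is_partition \<kappa>" "is_partition \<rho>"
    and "\<rho> 1 = max (\<mu> 1) (\<nu> 1) + k"
    and "\<And>m. 1 \<le> m \<Longrightarrow> \<kappa> m + \<rho> (Suc m) = reflection \<mu> \<nu> m"
  shows "size_fun \<kappa> + size_fun \<rho> = size_fun \<mu> + size_fun \<nu> + k"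
proof -
  have "finite ({m. \<mu> m \<noteq> 0} \<union> {m. \<nu> m \<noteq> 0} \<union> {m. \<kappa> m \<noteq> 0} \<union> {m. \<rho> m \<noteq> 0})"
    using assms by (simp add: is_partition_def)
  then obtain L where L: "\<And>m. m \<in> {m. \<mu> m \<noteq> 0} \<union> {m. \<nu> m \<noteq> 0} \<union> {m. \<kappa> m \<noteq> 0} \<union> {m. \<rho> m \<noteq> 0} \<Longrightarrow> m \<le> L"
    using finite_nat_set_iff_bounded_le by metis
  \<comment> \<open>Sizes are needed in two forms, one of them shifted, since a reflection pairs
    part \<open>m\<close> of \<kappa> with part \<open>m + 1\<close> of \<rho>.\<close>
  have size: "size_fun f = f 1 + (\<Sum>m\<in>{1..L}. f (Suc m))" 
             "size_fun f = (\<Sum>m\<in>{1..L}. f m)"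
    if "f 0 = 0" "\<And>m. f m \<noteq> 0 \<Longrightarrow> m \<le> L" for f
  proof -
    have "size_fun f = sum f {..L}"
      by (rule size_fun_eq) (use that in force)
    also have "\<dots> = sum f {1..L}"
      by (rule sum.mono_neutral_right) (use that in \<open>auto simp: not_less_eq_eq\<close>)
    finally show 2: "size_fun f = (\<Sum>m\<in>{1..L}. f m)" .
    have "size_fun f = sum f {..Suc L}"
      by (rule size_fun_eq) (use that in force)
    also have "\<dots> = (\<Sum>m\<le>L. f (Suc m))"
      using that(1) by (simp only: sum.atMost_Suc_shift)
    also have "\<dots> = f (Suc 0) + (\<Sum>m\<in>{1..L}. f (Suc m))"
      by (subst sum.remove[of _ 0]) (auto intro!: sum.cong)
    finally show "size_fun f = f 1 + (\<Sum>m\<in>{1..L}. f (Suc m))" by simp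
  qed
  have "size_fun \<kappa> + size_fun \<rho> = \<rho> 1 + (\<Sum>m\<in>{1..L}. \<kappa> m + \<rho> (Suc m))"
    using L assms(3,4) by (subst size(2)[of \<kappa>], simp_all add: is_partition_def, subst size(1)[of \<rho>])
      (auto simp: sum.distrib)
  also have "\<dots> = k + (max (\<mu> 1) (\<nu> 1) + (\<Sum>m\<in>{1..L}. max (\<mu> (Suc m)) (\<nu> (Suc m)))) + (\<Sum>m\<in>{1..L}. min (\<mu> m) (\<nu> m))"
    using assms(5,6) by (simp add: sum.distrib reflection_def)
  also have "\<dots> = k + size_fun (\<lambda>m. max (\<mu> m) (\<nu> m)) + size_fun (\<lambda>m. min (\<mu> m) (\<nu> m))"
  proof -
    have "size_fun (\<lambda>m. max (\<mu> m) (\<nu> m)) = max (\<mu> 1) (\<nu> 1) + (\<Sum>m\<in>{1..L}. max (\<mu> (Suc m)) (\<nu> (Suc m)))"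
      by (rule size(1)) (use L assms(1,2) in \<open>auto simp: is_partition_def max_def split: if_splits\<close>)
    moreover have "size_fun (\<lambda>m. min (\<mu> m) (\<nu> m)) = (\<Sum>m\<in>{1..L}. min (\<mu> m) (\<nu> m))"
      by (rule size(2)) (use L assms(1,2) in \<open>auto simp: is_partition_def min_def split: if_splits\<close>)
    ultimately show ?thesis by simp
  qed
  also have "\<dots> = k + size_fun ((\<lambda>m. max (\<mu> m) (\<nu> m)) + (\<lambda>m. min (\<mu> m) (\<nu> m)))"
    by (subst size_fun_add) (use L in \<open>auto intro!: finite_subset[of _ "{..L}"] simp: max_def min_def split: if_splits\<close>)
  also have "(\<lambda>m. max (\<mu> m) (\<nu> m)) + (\<lambda>m. min (\<mu> m) (\<nu> m)) = \<mu> + \<nu>"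
    by (auto simp: fun_eq_iff max_def min_def)
  also have "k + size_fun (\<mu> + \<nu>) = size_fun \<mu> + size_fun \<nu> + k"
    by (subst size_fun_add) (use assms(1,2) in \<open>auto simp: is_partition_def\<close>)
  finally show ?thesis .
qed

text \<open>Part \<open>m + 1\<close> of \<rho> lies in the interval that is reflected, so the
  subtraction in \<open>lower_corner\<close> is not truncated and its result lies in the same
  interval.\<close>

lemma lower_corner_strip:
  assumes "horizontal_strip \<mu> \<rho>" "horizontal_strip \<nu> \<rho>" "1 \<le> m"
  shows "lower_corner \<mu> \<nu> \<rho> m + \<rho> (Suc m) = reflection \<mu> \<nu> m"
    and "lower_corner \<mu> \<nu> \<rho> m \<le> min (\<mu> m) (\<nu> m)"
    and "max (\<mu> (Suc m)) (\<nu> (Suc m)) \<le> lower_corner \<mu> \<nu> \<rho> m"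
proof -
  have "max (\<mu> (Suc m)) (\<nu> (Suc m)) \<le> \<rho> (Suc m)" "\<rho> (Suc m) \<le> min (\<mu> m) (\<nu> m)"
    using assms by (auto simp: horizontal_strip_def)
  then show "lower_corner \<mu> \<nu> \<rho> m + \<rho> (Suc m) = reflection \<mu> \<nu> m"
    and "lower_corner \<mu> \<nu> \<rho> m \<le> min (\<mu> m) (\<nu> m)"
    and "max (\<mu> (Suc m)) (\<nu> (Suc m)) \<le> lower_corner \<mu> \<nu> \<rho> m"
    using assms(3) unfolding lower_corner_def reflection_def by auto
qed

lemma upper_corner_strip:
  assumes "horizontal_strip \<kappa> \<mu>" "horizontal_strip \<kappa> \<nu>" "1 \<le> m"
  shows "\<kappa> m + upper_corner \<mu> \<nu> k \<kappa> (Suc m) = reflection \<mu> \<nu> m"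
    and "upper_corner \<mu> \<nu> k \<kappa> (Suc m) \<le> min (\<mu> m) (\<nu> m)"
    and "max (\<mu> (Suc m)) (\<nu> (Suc m)) \<le> upper_corner \<mu> \<nu> k \<kappa> (Suc m)"
proof -
  have "max (\<mu> (Suc m)) (\<nu> (Suc m)) \<le> \<kappa> m" "\<kappa> m \<le> min (\<mu> m) (\<nu> m)"
    using assms by (auto simp: horizontal_strip_def)
  then show "\<kappa> m + upper_corner \<mu> \<nu> k \<kappa> (Suc m) = reflection \<mu> \<nu> m"
    and "upper_corner \<mu> \<nu> k \<kappa> (Suc m) \<le> min (\<mu> m) (\<nu> m)"
    and "max (\<mu> (Suc m)) (\<nu> (Suc m)) \<le> upper_corner \<mu> \<nu> k \<kappa> (Suc m)"
    using assms(3) unfolding upper_corner_def reflection_def by auto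
qed

lemma lower_corner_strips:
  assumes "horizontal_strip \<mu> \<rho>" "horizontal_strip \<nu> \<rho>"
  shows "horizontal_strip (lower_corner \<mu> \<nu> \<rho>) \<mu>" "horizontal_strip (lower_corner \<mu> \<nu> \<rho>) \<nu>"
proof -
  note strip = lower_corner_strip[OF assms]
  have par: "is_partition \<mu>" "is_partition \<nu>"
    using assms by (auto simp: horizontal_strip_def)
  have "lower_corner \<mu> \<nu> \<rho> \<le> \<mu>"
    unfolding le_fun_def
  proof
    fix m show "lower_corner \<mu> \<nu> \<rho> m \<le> \<mu> m"
      using strip(2)[of m] by (cases "m = 0") (auto simp: lower_corner_def)
  qed
  then have "{m. lower_corner \<mu> \<nu> \<rho> m \<noteq> 0} \<subseteq> {m. \<mu> m \<noteq> 0}"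
    by (metis (mono_tags, lifting) Collect_mono le_fun_def le_zero_eq)
  then have "finite {m. lower_corner \<mu> \<nu> \<rho> m \<noteq> 0}"
    using par(1) finite_subset unfolding is_partition_def by blast
  \<comment> \<open>The interval for \<open>m + 1\<close> ends at a minimum of the same two numbers
    whose maximum begins the interval for \<open>m\<close>, so the reflected values
    decrease.\<close>
  moreover have "lower_corner \<mu> \<nu> \<rho> (Suc m) \<le> lower_corner \<mu> \<nu> \<rho> m" if "1 \<le> m" for m
    using strip(2)[of "Suc m"] strip(3)[of m] that by simp
  ultimately have "is_partition (lower_corner \<mu> \<nu> \<rho>)"
    unfolding is_partition_def by (simp add: lower_corner_def)
  then show "horizontal_strip (lower_corner \<mu> \<nu> \<rho>) \<mu>" "horizontal_strip (lower_corner \<mu> \<nu> \<rho>) \<nu>"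
    using strip par unfolding horizontal_strip_def by auto
qed

lemma upper_corner_strips:
  assumes "horizontal_strip \<kappa> \<mu>" "horizontal_strip \<kappa> \<nu>"
  shows "horizontal_strip \<mu> (upper_corner \<mu> \<nu> k \<kappa>)" "horizontal_strip \<nu> (upper_corner \<mu> \<nu> k \<kappa>)"
proof -
  let ?\<rho> = "upper_corner \<mu> \<nu> k \<kappa>"
  note strip = upper_corner_strip[OF assms, of _ k]
  have par: "is_partition \<mu>" "is_partition \<nu>"
    using assms by (auto simp: horizontal_strip_def)
  have first: "\<mu> 1 \<le> ?\<rho> 1" "\<nu> 1 \<le> ?\<rho> 1"
    by (auto simp: upper_corner_def)
  have bound: "\<mu> m \<le> ?\<rho> m \<and> \<nu> m \<le> ?\<rho> m" if "1 \<le> m" for m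
  proof (cases "m = 1")
    case True then show ?thesis using first by simp
  next
    case False
    then have "m = Suc (m - 1)" "1 \<le> m - 1"
      using that by auto
    then show ?thesis using strip(3)[of "m - 1"] by simp
  qed
  have "{m. ?\<rho> m \<noteq> 0} \<subseteq> insert 1 (Suc ` {m. \<mu> m \<noteq> 0})"
  proof
    fix m assume m: "m \<in> {m. ?\<rho> m \<noteq> 0}"
    show "m \<in> insert 1 (Suc ` {m. \<mu> m \<noteq> 0})"
    proof (cases "m \<le> 1")
      case True
      then show ?thesis
        using m by (cases m) (auto simp: upper_corner_def)
    next
      case False
      then obtain p where "m = Suc p" "1 \<le> p"
        by (intro that[of "m - 1"]) auto
      then show ?thesis using strip(2)[of p] m by auto
    qed
  qed
  then have "finite {m. ?\<rho> m \<noteq> 0}"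
    using par(1) unfolding is_partition_def by (meson finite.insertI finite_imageI finite_subset)
  moreover have "?\<rho> (Suc m) \<le> ?\<rho> m" if "1 \<le> m" for m
    using strip(2)[of m] bound[of m] that by simp
  ultimately have "is_partition ?\<rho>"
    unfolding is_partition_def by (simp add: upper_corner_def)
  then show "horizontal_strip \<mu> ?\<rho>" "horizontal_strip \<nu> ?\<rho>"
    using strip bound par unfolding horizontal_strip_def by auto
qed

text \<open>This is the commutation relation between adding and removing horizontal strips. Adding
  \<open>n\<close> cells and then removing \<open>d\<close> corresponds to removing
  \<open>d - k\<close> and then adding \<open>n - k\<close>. The ends \<mu> and \<nu> stay fixed;
  only the corner between them changes, from \<rho> to \<kappa>.\<close>

lemma strip_commutation:
  fixes g :: "(nat \<Rightarrow> nat) \<Rightarrow> nat"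
  assumes "is_partition \<mu>"
  shows "(\<Sum>\<rho> | horizontal_strip \<mu> \<rho> \<and> size_fun \<rho> = size_fun \<mu> + n.
            \<Sum>\<nu> | horizontal_strip \<nu> \<rho> \<and> size_fun \<nu> + d = size_fun \<rho>. g \<nu>) =
         (\<Sum>k\<le>min n d. \<Sum>\<kappa> | horizontal_strip \<kappa> \<mu> \<and> size_fun \<kappa> + (d - k) = size_fun \<mu>.
            \<Sum>\<nu> | horizontal_strip \<kappa> \<nu> \<and> size_fun \<nu> = size_fun \<kappa> + (n - k). g \<nu>)"
proof -
  let ?P = "SIGMA \<rho>:{\<rho>. horizontal_strip \<mu> \<rho> \<and> size_fun \<rho> = size_fun \<mu> + n}.
              {\<nu>. horizontal_strip \<nu> \<rho> \<and> size_fun \<nu> + d = size_fun \<rho>}"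
  let ?Q = "SIGMA k:{..min n d}. SIGMA \<kappa>:{\<kappa>. horizontal_strip \<kappa> \<mu> \<and> size_fun \<kappa> + (d - k) = size_fun \<mu>}.
              {\<nu>. horizontal_strip \<kappa> \<nu> \<and> size_fun \<nu> = size_fun \<kappa> + (n - k)}"
  have below: "finite {\<nu>. horizontal_strip \<nu> \<rho> \<and> P \<nu>}" for \<rho> P
    using finite_strips_below[of \<rho>] by (rule finite_subset[rotated]) auto
  have "(\<Sum>\<rho> | horizontal_strip \<mu> \<rho> \<and> size_fun \<rho> = size_fun \<mu> + n.
            \<Sum>\<nu> | horizontal_strip \<nu> \<rho> \<and> size_fun \<nu> + d = size_fun \<rho>. g \<nu>) = (\<Sum>(\<rho>, \<nu>)\<in>?P. g \<nu>)"
    by (rule sum.Sigma) (simp_all add: finite_strips_above below)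
  also have "\<dots> = (\<Sum>(k, \<kappa>, \<nu>)\<in>?Q. g \<nu>)"
  proof (rule sum.reindex_bij_witness[where i = "\<lambda>(k, \<kappa>, \<nu>). (upper_corner \<mu> \<nu> k \<kappa>, \<nu>)"
        and j = "\<lambda>(\<rho>, \<nu>). (\<rho> 1 - max (\<mu> 1) (\<nu> 1), lower_corner \<mu> \<nu> \<rho>, \<nu>)"])
    fix x assume "x \<in> ?P"
    then obtain \<rho> \<nu> where x: "x = (\<rho>, \<nu>)" and s: "horizontal_strip \<mu> \<rho>" "horizontal_strip \<nu> \<rho>"
      and size: "size_fun \<rho> = size_fun \<mu> + n" "size_fun \<nu> + d = size_fun \<rho>"
      by auto
    \<comment> \<open>The excess of the first part of \<rho> over both \<mu> and \<nu> is the only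
      information about \<rho> that \<kappa> loses; \<open>k\<close> keeps it.\<close>
    let ?\<kappa> = "lower_corner \<mu> \<nu> \<rho>" and ?k = "\<rho> 1 - max (\<mu> 1) (\<nu> 1)"
    have first: "\<rho> 1 = max (\<mu> 1) (\<nu> 1) + ?k"
      using s by (auto simp: horizontal_strip_def)
    note strips = lower_corner_strips[OF s]
    have "size_fun ?\<kappa> + size_fun \<rho> = size_fun \<mu> + size_fun \<nu> + ?k"
      by (rule corner_size) (use s strips first lower_corner_strip(1)[OF s] in \<open>auto simp: horizontal_strip_def\<close>)
    \<comment> \<open>Since \<kappa> is contained in both \<mu> and \<nu>, the size identity yields
      \<open>k \<le> d\<close> and \<open>k \<le> n\<close>.\<close>
    moreover have "size_fun ?\<kappa> \<le> size_fun \<mu>" "size_fun ?\<kappa> \<le> size_fun \<nu>"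
      using strips by (auto intro!: size_fun_mono horizontal_strip_le simp: horizontal_strip_def is_partition_def)
    ultimately show "(case x of (\<rho>, \<nu>) \<Rightarrow> (\<rho> 1 - max (\<mu> 1) (\<nu> 1), lower_corner \<mu> \<nu> \<rho>, \<nu>)) \<in> ?Q"
      using strips size x by auto
    have "upper_corner \<mu> \<nu> ?k ?\<kappa> = \<rho>"
    proof
      fix m
      consider "m = 0" | "m = 1" | p where "m = Suc p" "1 \<le> p"
        by (metis One_nat_def Suc_leI gr0I not0_implies_Suc)
      then show "upper_corner \<mu> \<nu> ?k ?\<kappa> m = \<rho> m"
      proof cases
        case 1
        then show ?thesis using s by (simp add: upper_corner_def horizontal_strip_def is_partition_def)
      next
        case 2
        then show ?thesis using first by (simp add: upper_corner_def)
      next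
        case 3
        then show ?thesis
          using lower_corner_strip(1)[OF s, of p] by (simp add: upper_corner_def)
      qed
    qed
    then show "(case (case x of (\<rho>, \<nu>) \<Rightarrow> (\<rho> 1 - max (\<mu> 1) (\<nu> 1), lower_corner \<mu> \<nu> \<rho>, \<nu>)) of
        (k, \<kappa>, \<nu>) \<Rightarrow> (upper_corner \<mu> \<nu> k \<kappa>, \<nu>)) = x"
      using x by simp
    show "(case case x of (\<rho>, \<nu>) \<Rightarrow> (\<rho> 1 - max (\<mu> 1) (\<nu> 1), lower_corner \<mu> \<nu> \<rho>, \<nu>) of
        (k, \<kappa>, \<nu>) \<Rightarrow> g \<nu>) = (case x of (\<rho>, \<nu>) \<Rightarrow> g \<nu>)"
      using x by simp
  next
    fix y assume "y \<in> ?Q"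
    then obtain k \<kappa> \<nu> where y: "y = (k, \<kappa>, \<nu>)" and k: "k \<le> n" "k \<le> d"
      and s: "horizontal_strip \<kappa> \<mu>" "horizontal_strip \<kappa> \<nu>"
      and size: "size_fun \<kappa> + (d - k) = size_fun \<mu>" "size_fun \<nu> = size_fun \<kappa> + (n - k)"
      by auto
    let ?\<rho> = "upper_corner \<mu> \<nu> k \<kappa>"
    note strips = upper_corner_strips[OF s, of k]
    have first: "?\<rho> 1 = max (\<mu> 1) (\<nu> 1) + k"
      by (simp add: upper_corner_def)
    from first have "size_fun \<kappa> + size_fun ?\<rho> = size_fun \<mu> + size_fun \<nu> + k"
      by (intro corner_size) (use s strips upper_corner_strip(1)[OF s] in \<open>auto simp: horizontal_strip_def\<close>)
    then show "(case y of (k, \<kappa>, \<nu>) \<Rightarrow> (upper_corner \<mu> \<nu> k \<kappa>, \<nu>)) \<in> ?P"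
      using strips size y k by auto
    have "lower_corner \<mu> \<nu> ?\<rho> = \<kappa>"
    proof
      fix m
      show "lower_corner \<mu> \<nu> ?\<rho> m = \<kappa> m"
        using upper_corner_strip(1)[OF s, of m k] s
        by (cases "m = 0") (auto simp: lower_corner_def horizontal_strip_def is_partition_def)
    qed
    then show "(case (case y of (k, \<kappa>, \<nu>) \<Rightarrow> (upper_corner \<mu> \<nu> k \<kappa>, \<nu>)) of
       (\<rho>, \<nu>) \<Rightarrow> (\<rho> 1 - max (\<mu> 1) (\<nu> 1), lower_corner \<mu> \<nu> \<rho>, \<nu>)) = y"
      using y first by simp
  qed
  also have "\<dots> = (\<Sum>k\<le>min n d. \<Sum>(\<kappa>, \<nu>) \<in> (SIGMA \<kappa>:{\<kappa>. horizontal_strip \<kappa> \<mu> \<and> size_fun \<kappa> + (d - k) = size_fun \<mu>}.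
              {\<nu>. horizontal_strip \<kappa> \<nu> \<and> size_fun \<nu> = size_fun \<kappa> + (n - k)}). g \<nu>)"
    by (subst sum.Sigma[symmetric]) (auto intro!: finite_SigmaI simp: finite_strips_above below)
  also have "\<dots> = (\<Sum>k\<le>min n d. \<Sum>\<kappa> | horizontal_strip \<kappa> \<mu> \<and> size_fun \<kappa> + (d - k) = size_fun \<mu>.
            \<Sum>\<nu> | horizontal_strip \<kappa> \<nu> \<and> size_fun \<nu> = size_fun \<kappa> + (n - k). g \<nu>)"
    by (intro sum.cong refl sum.Sigma[symmetric]) (simp_all add: finite_strips_above below)
  finally show ?thesis .
qed

subsection \<open>Kostka numbers and the rule of Pieri\<close>

lemma finite_ssyt_cont:
  assumes "finite D" "finite {m. e m \<noteq> 0}"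
  shows "finite {T \<in> ssyt D. cont T = e}"
proof -
  obtain L where L: "\<And>m. L < m \<Longrightarrow> e m = 0"
    using assms(2) finite_support_bound by blast
  have bound: "T r c \<le> L" if "T \<in> ssyt D" "cont T = e" "(r, c) \<in> D" for T r c
  proof (rule ccontr)
    assume "\<not> T r c \<le> L"
    then have "cont T (T r c) = 0" using L that(2) by simp
    moreover have "{(r', c'). T r' c' = T r c} \<subseteq> D"
      using that by (auto simp: ssyt_def)
    then have "finite {(r', c'). T r' c' = T r c}"
      using assms(1) finite_subset by blast
    ultimately have "{(r', c'). T r' c' = T r c} = {} \<or> T r c = 0"
      by (auto simp: cont_def)
    then show False
      using that by (auto simp: ssyt_def)
  qed
  \<comment> \<open>Uncurrying makes a filling a function on cells, bounded by \<open>L\<close> on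
    \<open>D\<close> and with default value 0 elsewhere.\<close>
  have "(\<lambda>T (r, c). T r c) ` {T \<in> ssyt D. cont T = e} \<subseteq>
     {f. \<forall>x. (x \<in> D \<longrightarrow> f x \<in> {..L}) \<and> (x \<notin> D \<longrightarrow> f x = 0)}"
    using bound by (force simp: ssyt_def not_less_eq_eq)
  moreover have "finite {f. \<forall>x. (x \<in> D \<longrightarrow> f x \<in> {..L}) \<and> (x \<notin> D \<longrightarrow> f x = (0::nat))}"
    by (intro finite_set_of_finite_funs) (use assms in auto)
  moreover have "inj (\<lambda>T (r :: nat, c :: nat). (T r c :: nat))"
    by (rule injI) (auto simp: fun_eq_iff)
  ultimately show ?thesis
    by (meson finite_imageD finite_subset inj_on_subset subset_UNIV)
qed

lemma horizontal_strip_partition: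
  "horizontal_strip \<mu> \<rho> \<Longrightarrow> is_partition \<mu>" "horizontal_strip \<mu> \<rho> \<Longrightarrow> is_partition \<rho>"
  by (auto simp: horizontal_strip_def)

lemma young_diagram_Sigma: "young_diagram \<rho> = (SIGMA r:{r. 1 \<le> r \<and> \<rho> r \<noteq> 0}. {1..\<rho> r})"
  by (auto simp: young_diagram_def)

lemma finite_young_diagram: "is_partition \<rho> \<Longrightarrow> finite (young_diagram \<rho>)"
  unfolding young_diagram_Sigma is_partition_def by (rule finite_SigmaI) auto

lemma card_young_diagram:
  assumes "is_partition \<rho>"
  shows "card (young_diagram \<rho>) = size_fun \<rho>"
proof -
  have "{r. 1 \<le> r \<and> \<rho> r \<noteq> 0} = {r. \<rho> r \<noteq> 0}"
    using assms by (auto simp: is_partition_def Suc_le_eq intro!: gr0I)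
  then show ?thesis
    unfolding young_diagram_Sigma size_fun_def
    using assms by (simp add: is_partition_def)
qed

lemma young_diagram_inj:
  assumes "young_diagram \<rho> = young_diagram \<kappa>" "\<rho> 0 = \<kappa> 0"
  shows "\<rho> = \<kappa>"
proof
  fix m
  show "\<rho> m = \<kappa> m"
  proof (cases "m = 0")
    case False
    then have "c \<le> \<rho> m \<longleftrightarrow> c \<le> \<kappa> m" if "1 \<le> c" for c
      using that eqset_imp_iff[OF assms(1), of "(m, c)"] by (simp add: young_diagram_def)
    from this[of "\<rho> m"] this[of "\<kappa> m"] show ?thesis
      by linarith
  qed (use assms(2) in simp)
qed

text \<open>As \<open>card\<close> is 0 on infinite sets, the finiteness of \<open>D\<close> is what
  guarantees that a letter which occurs has positive content.\<close>

lemma cont_entry_pos: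
  assumes "T \<in> ssyt D" "finite D" "(r, c) \<in> D"
  shows "0 < cont T (T r c)"
proof -
  have "{(r', c'). T r' c' = T r c} \<subseteq> D"
    using assms by (auto simp: ssyt_def)
  then have "finite {(r', c'). T r' c' = T r c}"
    using assms(2) finite_subset by blast
  moreover have "(r, c) \<in> {(r', c'). T r' c' = T r c}" "T r c \<noteq> 0"
    using assms by (auto simp: ssyt_def)
  ultimately show ?thesis
    by (auto simp: cont_def card_gt_0_iff)
qed

text \<open>A nonempty diagram has a cell in column 1, and its entry makes the content nonzero. This
  starts the induction in \<open>pieri\<close> and serves \<open>card_ribbon_words\<close> at the
  empty shape.\<close>

lemma kostka_0:
  assumes "is_partition \<rho>"
  shows "kostka \<rho> 0 = (if \<rho> = 0 then 1 else 0)"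
proof (cases "\<rho> = 0")
  case True
  then have "young_diagram \<rho> = {}"
    by (auto simp: young_diagram_def)
  then have "{T \<in> ssyt (young_diagram \<rho>). cont T = 0} = {\<lambda>r c. 0}"
    by (auto simp: ssyt_def cont_def fun_eq_iff not_less_eq_eq)
  then show ?thesis
    using True by (simp add: kostka_def)
next
  case False
  then obtain m where "\<rho> m \<noteq> 0"
    by (auto simp: fun_eq_iff)
  then have cell: "(m, 1) \<in> young_diagram \<rho>"
    using assms by (cases m) (auto simp: young_diagram_def is_partition_def)
  have none: False if "T \<in> ssyt (young_diagram \<rho>)" "cont T = 0" for T
    using cont_entry_pos[OF that(1) finite_young_diagram[OF assms] cell] that(2) by simp
  then have empty: "{T \<in> ssyt (young_diagram \<rho>). cont T = 0} = {}"
    by blast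
  show ?thesis
    unfolding kostka_def empty using False by simp
qed

section \<open>Removing the largest letter from a tableau\<close>

definition truncate_filling :: "nat \<Rightarrow> (nat \<Rightarrow> nat \<Rightarrow> nat) \<Rightarrow> nat \<Rightarrow> nat \<Rightarrow> nat" where
  "truncate_filling N T r c = (if T r c \<le> N then T r c else 0)"

definition inner_shape :: "nat \<Rightarrow> (nat \<Rightarrow> nat \<Rightarrow> nat) \<Rightarrow> nat \<Rightarrow> nat" where
  "inner_shape N T r = card {c. 1 \<le> T r c \<and> T r c \<le> N}"

text \<open>When \<open>a\<close> is the largest letter, this is the inverse of passing to
  \<open>inner_shape\<close> and \<open>truncate_filling\<close>.\<close>

definition extend_filling :: "(nat \<Rightarrow> nat) \<Rightarrow> (nat \<Rightarrow> nat) \<Rightarrow> nat \<Rightarrow> (nat \<Rightarrow> nat \<Rightarrow> nat) \<Rightarrow> nat \<Rightarrow> nat \<Rightarrow> nat" where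
  "extend_filling \<kappa> \<rho> a T r c = (if (r, c) \<in> young_diagram \<rho> - young_diagram \<kappa> then a else T r c)"

lemma initial_segment_card:
  assumes "S \<subseteq> {1..n::nat}" "\<And>a b. b \<in> S \<Longrightarrow> 1 \<le> a \<Longrightarrow> a \<le> b \<Longrightarrow> a \<in> S"
  shows "S = {1..card S}"
proof (cases "S = {}")
  case False
  have fin: "finite S" using assms(1) finite_subset by blast
  then have "Max S \<in> S" using False by simp
  then have "S = {1..Max S}"
  proof (intro equalityI subsetI)
    fix a assume "a \<in> S"
    then show "a \<in> {1..Max S}" using assms(1) fin by auto
  next
    fix a assume "a \<in> {1..Max S}"
    then show "a \<in> S" using assms(2)[OF \<open>Max S \<in> S\<close>, of a] by simp
  qed
  then show ?thesis
    by (metis card_atLeastAtMost diff_Suc_1)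
qed simp

text \<open>Rows increase weakly and start in column 1, so the entries up to \<open>N\<close> fill
  an initial segment of each row, and their number is a row length.\<close>

lemma inner_shape_diagram:
  assumes "T \<in> ssyt (young_diagram \<rho>)"
  shows "young_diagram (inner_shape N T) = {(r, c). (r, c) \<in> young_diagram \<rho> \<and> T r c \<le> N}"
proof -
  have "{c. 1 \<le> T r c \<and> T r c \<le> N} = {1..inner_shape N T r}" for r
    unfolding inner_shape_def
  proof (rule initial_segment_card)
    show "{c. 1 \<le> T r c \<and> T r c \<le> N} \<subseteq> {1..\<rho> r}"
    proof
      fix c assume "c \<in> {c. 1 \<le> T r c \<and> T r c \<le> N}"
      then have "(r, c) \<in> young_diagram \<rho>"
        using assms by (auto simp: ssyt_def)
      then show "c \<in> {1..\<rho> r}" by (simp add: young_diagram_def)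
    qed
  next
    fix a b assume ab: "b \<in> {c. 1 \<le> T r c \<and> T r c \<le> N}" "1 \<le> a" "a \<le> b"
    then have "(r, b) \<in> young_diagram \<rho>"
      using assms by (auto simp: ssyt_def)
    moreover from this have "(r, a) \<in> young_diagram \<rho>"
      using ab by (simp add: young_diagram_def)
    ultimately have cells: "(r, b) \<in> young_diagram \<rho>" "(r, a) \<in> young_diagram \<rho>" .
    then have "1 \<le> T r a" "a < b \<longrightarrow> T r a \<le> T r b"
      using assms by (auto simp: ssyt_def)
    then show "a \<in> {c. 1 \<le> T r c \<and> T r c \<le> N}"
      using ab by (cases "a = b") auto
  qed
  then have row: "1 \<le> T r c \<and> T r c \<le> N \<longleftrightarrow> 1 \<le> c \<and> c \<le> inner_shape N T r" for r c
    by (auto simp: set_eq_iff)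
  have "(r, c) \<in> young_diagram \<rho> \<longleftrightarrow> 1 \<le> T r c" for r c
    using assms by (auto simp: ssyt_def)
  moreover have "1 \<le> r" if "(r, c) \<in> young_diagram \<rho>" for r c
    using that by (simp add: young_diagram_def)
  moreover have "(r, c) \<in> young_diagram (inner_shape N T) \<longleftrightarrow> 1 \<le> r \<and> 1 \<le> T r c \<and> T r c \<le> N" for r c
    using row[of r c] by (auto simp: young_diagram_def)
  ultimately show ?thesis
    by auto
qed

text \<open>Columns increase strictly, so no two cells with the largest letter \<open>Suc N\<close>
  share a column: they form a horizontal strip of size \<open>e (Suc N)\<close> around the shape of
  the rest.\<close>

lemma inner_shape_strip:
  assumes "is_partition \<rho>" "T \<in> ssyt (young_diagram \<rho>)" "cont T = e"
    and "\<And>m. Suc N < m \<Longrightarrow> e m = 0"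
  shows "horizontal_strip (inner_shape N T) \<rho>"
    and "size_fun (inner_shape N T) + e (Suc N) = size_fun \<rho>"
    and "truncate_filling N T \<in> ssyt (young_diagram (inner_shape N T))"
    and "cont (truncate_filling N T) = e(Suc N := 0)"
proof -
  let ?\<kappa> = "inner_shape N T"
  note diagram = inner_shape_diagram[OF assms(2), of N]
  have ssyt: "(r, c) \<in> young_diagram \<rho> \<longleftrightarrow> 1 \<le> T r c"
    "(r, c) \<in> young_diagram \<rho> \<Longrightarrow> (r, c') \<in> young_diagram \<rho> \<Longrightarrow> c < c' \<Longrightarrow> T r c \<le> T r c'"
    "(r, c) \<in> young_diagram \<rho> \<Longrightarrow> (r', c) \<in> young_diagram \<rho> \<Longrightarrow> r < r' \<Longrightarrow> T r c < T r' c" for r r' c c'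
    using assms(2) by (auto simp: ssyt_def)
  have bound: "T r c \<le> Suc N" for r c
  proof (cases "(r, c) \<in> young_diagram \<rho>")
    case True
    then show ?thesis
      using cont_entry_pos[OF assms(2) finite_young_diagram[OF assms(1)] True] assms(3,4)
      by (metis less_numeral_extra(3) not_le)
  next
    case False
    then show ?thesis using ssyt(1)[of r c] by simp
  qed
  have zero: "?\<kappa> 0 = 0"
  proof -
    have "T 0 c = 0" for c
      using ssyt(1)[of 0 c] by (simp add: young_diagram_def)
    then show ?thesis by (simp add: inner_shape_def)
  qed
  have le: "?\<kappa> m \<le> \<rho> m" if "1 \<le> m" for m
  proof (cases "?\<kappa> m = 0")
    case False
    then have "(m, ?\<kappa> m) \<in> young_diagram ?\<kappa>"
      using that by (simp add: young_diagram_def)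
    then show ?thesis
      unfolding diagram by (simp add: young_diagram_def)
  qed simp
  \<comment> \<open>The last cell of row \<open>m + 1\<close> of \<rho> has a cell directly above
    it. The entry there is smaller than some entry that is at most \<open>Suc N\<close>, so this
    upper cell belongs to the inner shape.\<close>
  have ge: "\<rho> (Suc m) \<le> ?\<kappa> m" if "1 \<le> m" for m
  proof (cases "\<rho> (Suc m) = 0")
    case False
    then have cells: "(Suc m, \<rho> (Suc m)) \<in> young_diagram \<rho>" "(m, \<rho> (Suc m)) \<in> young_diagram \<rho>"
      using that assms(1) by (auto simp: young_diagram_def is_partition_def)
    then have "T m (\<rho> (Suc m)) < T (Suc m) (\<rho> (Suc m))"
      by (intro ssyt(3)) auto
    then have "T m (\<rho> (Suc m)) \<le> N"
      using bound[of "Suc m" "\<rho> (Suc m)"] by simp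
    then have "(m, \<rho> (Suc m)) \<in> young_diagram ?\<kappa>"
      unfolding diagram using cells by simp
    then show ?thesis by (simp add: young_diagram_def)
  qed simp
  have "{m. ?\<kappa> m \<noteq> 0} \<subseteq> {m. \<rho> m \<noteq> 0}"
  proof
    fix m assume "m \<in> {m. ?\<kappa> m \<noteq> 0}"
    then show "m \<in> {m. \<rho> m \<noteq> 0}"
      using zero le[of m] by (cases m) auto
  qed
  then have "finite {m. ?\<kappa> m \<noteq> 0}"
    using assms(1) finite_subset unfolding is_partition_def by blast
  moreover have "?\<kappa> (Suc m) \<le> ?\<kappa> m" if "1 \<le> m" for m
    using le[of "Suc m"] ge[OF that] by simp
  ultimately have par: "is_partition ?\<kappa>"
    using zero by (simp add: is_partition_def)
  then show "horizontal_strip ?\<kappa> \<rho>"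
    using assms(1) le ge by (simp add: horizontal_strip_def)
  have split: "young_diagram \<rho> = young_diagram ?\<kappa> \<union> {(r, c). T r c = Suc N}"
    unfolding diagram using ssyt(1) bound by (auto simp: le_Suc_eq)
  have "card (young_diagram \<rho>) = card (young_diagram ?\<kappa>) + card {(r, c). T r c = Suc N}"
    unfolding split
  proof (rule card_Un_disjoint)
    show "finite (young_diagram ?\<kappa>)" "finite {(r, c). T r c = Suc N}"
      using finite_young_diagram[OF assms(1)] split by (metis finite_Un)+
    show "young_diagram ?\<kappa> \<inter> {(r, c). T r c = Suc N} = {}"
      unfolding diagram by auto
  qed
  then show "size_fun ?\<kappa> + e (Suc N) = size_fun \<rho>"
    using assms(1,3) par by (auto simp: card_young_diagram cont_def)
  show "truncate_filling N T \<in> ssyt (young_diagram ?\<kappa>)"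
    using ssyt unfolding ssyt_def diagram by (auto simp: truncate_filling_def)
  show "cont (truncate_filling N T) = e(Suc N := 0)"
  proof
    fix m
    have "{(r, c). truncate_filling N T r c = m} = (if m \<le> N then {(r, c). T r c = m} else {})" if "m \<noteq> 0"
      using that by (auto simp: truncate_filling_def)
    then show "cont (truncate_filling N T) m = (e(Suc N := 0)) m"
      using assms(3) assms(4)[of m] by (auto simp: cont_def split: if_splits)
  qed
qed

text \<open>A cell of the strip is the lowest of its column and lies to the right of \<kappa> in its
  row, so writing the largest letter there respects rows and columns.\<close>

lemma extend_filling_ssyt:
  assumes strip: "horizontal_strip \<kappa> \<rho>" and size: "size_fun \<kappa> + e (Suc N) = size_fun \<rho>"
    and T: "T \<in> ssyt (young_diagram \<kappa>)" "cont T = e(Suc N := 0)"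
    and e: "\<And>m. Suc N < m \<Longrightarrow> e m = 0"
  shows "extend_filling \<kappa> \<rho> (Suc N) T \<in> ssyt (young_diagram \<rho>)"
    and "cont (extend_filling \<kappa> \<rho> (Suc N) T) = e"
    and "inner_shape N (extend_filling \<kappa> \<rho> (Suc N) T) = \<kappa>"
    and "truncate_filling N (extend_filling \<kappa> \<rho> (Suc N) T) = T"
proof -
  let ?T = "extend_filling \<kappa> \<rho> (Suc N) T"
  have par: "is_partition \<kappa>" "is_partition \<rho>"
    using strip by (auto simp: horizontal_strip_def)
  have sub: "young_diagram \<kappa> \<subseteq> young_diagram \<rho>"
    using strip by (force simp: young_diagram_def horizontal_strip_def intro: order_trans)
  have ssyt: "(r, c) \<in> young_diagram \<kappa> \<longleftrightarrow> 1 \<le> T r c"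
    "(r, c) \<in> young_diagram \<kappa> \<Longrightarrow> (r, c') \<in> young_diagram \<kappa> \<Longrightarrow> c < c' \<Longrightarrow> T r c \<le> T r c'"
    "(r, c) \<in> young_diagram \<kappa> \<Longrightarrow> (r', c) \<in> young_diagram \<kappa> \<Longrightarrow> r < r' \<Longrightarrow> T r c < T r' c" for r r' c c'
    using T(1) by (auto simp: ssyt_def)
  have bound: "T r c \<le> N" for r c
  proof (cases "(r, c) \<in> young_diagram \<kappa>")
    case True
    have "0 < (e(Suc N := 0)) (T r c)"
      using cont_entry_pos[OF T(1) finite_young_diagram[OF par(1)] True] T(2) by simp
    then have "T r c \<noteq> Suc N" "\<not> Suc N < T r c"
      using e by (auto split: if_splits)
    then show ?thesis by simp
  next
    case False
    then show ?thesis using ssyt(1)[of r c] by simp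
  qed
  have mono: "\<mu> r' \<le> \<mu> r" if "is_partition \<mu>" "1 \<le> r" "r \<le> r'" for \<mu> r r'
    using that(3) by (induction rule: dec_induct) (use that(1,2) in \<open>auto simp: is_partition_def intro: order_trans\<close>)
  have above: "(r, c) \<in> young_diagram \<kappa>" if "1 \<le> r" "r < r'" "(r', c) \<in> young_diagram \<rho>" for r r' c
  proof -
    have "c \<le> \<rho> (Suc r)"
      using that mono[OF par(2), of "Suc r" r'] by (auto simp: young_diagram_def)
    then show ?thesis
      using that strip by (fastforce simp: young_diagram_def horizontal_strip_def)
  qed
  have left: "(r, c) \<in> young_diagram \<kappa>" if "1 \<le> c" "c < c'" "(r, c') \<in> young_diagram \<kappa>" for r c c'
    using that by (auto simp: young_diagram_def)
  have val: "?T r c = (if (r, c) \<in> young_diagram \<kappa> then T r c else if (r, c) \<in> young_diagram \<rho> then Suc N else 0)" for r c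
    using sub ssyt(1)[of r c] by (auto simp: extend_filling_def)
  show filled: "?T \<in> ssyt (young_diagram \<rho>)"
    unfolding ssyt_def mem_Collect_eq
  proof (intro conjI allI impI)
    fix r c show "(r, c) \<in> young_diagram \<rho> \<longleftrightarrow> 1 \<le> ?T r c"
      using val[of r c] ssyt(1)[of r c] sub by auto
  next
    fix r c c' assume *: "(r, c) \<in> young_diagram \<rho> \<and> (r, c') \<in> young_diagram \<rho> \<and> c < c'"
    then have "1 \<le> c" by (simp add: young_diagram_def)
    then show "?T r c \<le> ?T r c'"
      using * val ssyt(2)[of r c c'] left[of c c' r] bound[of r c] by auto
  next
    fix r r' c assume *: "(r, c) \<in> young_diagram \<rho> \<and> (r', c) \<in> young_diagram \<rho> \<and> r < r'"
    then have "(r, c) \<in> young_diagram \<kappa>"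
      by (intro above[of r r' c]) (auto simp: young_diagram_def)
    then show "?T r c < ?T r' c"
      using * val ssyt(3)[of r c r'] bound[of r c] by auto
  qed
  have inner: "young_diagram (inner_shape N ?T) = young_diagram \<kappa>"
    unfolding inner_shape_diagram[OF filled] using sub val bound by auto
  have "?T 0 c = 0" for c
    using val[of 0 c] by (simp add: young_diagram_def)
  then have "inner_shape N ?T 0 = 0"
    by (simp add: inner_shape_def)
  then show "inner_shape N ?T = \<kappa>"
    using inner par(1) by (intro young_diagram_inj) (auto simp: is_partition_def)
  show "truncate_filling N ?T = T"
  proof (intro ext)
    fix r c show "truncate_filling N ?T r c = T r c"
      using val[of r c] bound[of r c] ssyt(1)[of r c] by (auto simp: truncate_filling_def)
  qed
  have new: "{(r, c). ?T r c = Suc N} = young_diagram \<rho> - young_diagram \<kappa>"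
  proof -
    have "?T r c = Suc N \<longleftrightarrow> (r, c) \<in> young_diagram \<rho> - young_diagram \<kappa>" for r c
      using val[of r c] bound[of r c] by auto
    then show ?thesis by auto
  qed
  have old: "{(r, c). ?T r c = m} = {(r, c). T r c = m}" if "m \<noteq> 0" "m \<noteq> Suc N" for m
  proof -
    have "?T r c = m \<longleftrightarrow> T r c = m" for r c
      using that val[of r c] ssyt(1)[of r c] by auto
    then show ?thesis by auto
  qed
  show "cont ?T = e"
  proof
    fix m
    consider "m = 0" | "m = Suc N" | "m \<noteq> 0" "m \<noteq> Suc N" by blast
    then show "cont ?T m = e m"
    proof cases
      case 1
      then show ?thesis using fun_cong[OF T(2), of 0] by (simp add: cont_def)
    next
      case 2
      have "card (young_diagram \<rho> - young_diagram \<kappa>) = e (Suc N)"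
        using sub par size by (subst card_Diff_subset) (auto simp: finite_young_diagram card_young_diagram)
      then show ?thesis using 2 new by (simp add: cont_def)
    next
      case 3
      then show ?thesis using old fun_cong[OF T(2), of m] by (simp add: cont_def)
    qed
  qed
qed

text \<open>The branching rule: a tableau amounts to the strip of its largest letters and the
  tableau that remains. If \<open>e (Suc N)\<close> is 0, the strip is empty.\<close>

lemma kostka_remove_strip:
  assumes "is_partition \<rho>" "\<And>m. Suc N < m \<Longrightarrow> e m = 0"
  shows "kostka \<rho> e = (\<Sum>\<kappa> | horizontal_strip \<kappa> \<rho> \<and> size_fun \<kappa> + e (Suc N) = size_fun \<rho>.
      kostka \<kappa> (e(Suc N := 0)))"
proof -
  let ?K = "{\<kappa>. horizontal_strip \<kappa> \<rho> \<and> size_fun \<kappa> + e (Suc N) = size_fun \<rho>}"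
  let ?S = "\<lambda>\<kappa>. {T \<in> ssyt (young_diagram \<kappa>). cont T = e(Suc N := 0)}"
  have "bij_betw (\<lambda>T. (inner_shape N T, truncate_filling N T))
     {T \<in> ssyt (young_diagram \<rho>). cont T = e} (Sigma ?K ?S)"
  proof (rule bij_betw_byWitness[where f' = "\<lambda>(\<kappa>, T). extend_filling \<kappa> \<rho> (Suc N) T"])
    show "\<forall>T\<in>{T \<in> ssyt (young_diagram \<rho>). cont T = e}.
       (case (inner_shape N T, truncate_filling N T) of (\<kappa>, T) \<Rightarrow> extend_filling \<kappa> \<rho> (Suc N) T) = T"
    proof (clarsimp, intro ext)
      fix T r c assume T: "T \<in> ssyt (young_diagram \<rho>)" "e = cont T"
      have "T r c \<le> Suc N" if "(r, c) \<in> young_diagram \<rho>"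
        using cont_entry_pos[OF T(1) finite_young_diagram[OF assms(1)] that] assms(2) T(2)
        by (metis less_numeral_extra(3) not_le)
      moreover have "(r, c) \<in> young_diagram \<rho> \<longleftrightarrow> 1 \<le> T r c"
        using T by (auto simp: ssyt_def)
      ultimately show "extend_filling (inner_shape N T) \<rho> (Suc N) (truncate_filling N T) r c = T r c"
        by (auto simp: extend_filling_def inner_shape_diagram[OF T(1)] truncate_filling_def le_Suc_eq)
    qed
  next
    show "\<forall>x\<in>Sigma ?K ?S. (inner_shape N (case x of (\<kappa>, T) \<Rightarrow> extend_filling \<kappa> \<rho> (Suc N) T),
        truncate_filling N (case x of (\<kappa>, T) \<Rightarrow> extend_filling \<kappa> \<rho> (Suc N) T)) = x"
      using extend_filling_ssyt[of _ \<rho> e N] assms(2) by auto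
  next
    show "(\<lambda>T. (inner_shape N T, truncate_filling N T)) ` {T \<in> ssyt (young_diagram \<rho>). cont T = e} \<subseteq> Sigma ?K ?S"
      using inner_shape_strip[OF assms(1), of _ e N] assms(2) by auto
  next
    show "(\<lambda>(\<kappa>, T). extend_filling \<kappa> \<rho> (Suc N) T) ` Sigma ?K ?S \<subseteq> {T \<in> ssyt (young_diagram \<rho>). cont T = e}"
      using extend_filling_ssyt[of _ \<rho> e N] assms(2) by auto
  qed
  then have "kostka \<rho> e = card (Sigma ?K ?S)"
    unfolding kostka_def by (rule bij_betw_same_card)
  also have "\<dots> = (\<Sum>\<kappa>\<in>?K. card (?S \<kappa>))"
  proof (rule card_SigmaI)
    show "finite ?K"
      using finite_strips_below[of \<rho>] by (rule finite_subset[rotated]) auto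
    have "{m. (e(Suc N := 0)) m \<noteq> 0} \<subseteq> {..Suc N}"
      using assms(2) by (auto simp del: not_le simp flip: not_less)
    then have "finite {m. (e(Suc N := 0)) m \<noteq> 0}"
      using finite_subset by blast
    then show "\<forall>\<kappa>\<in>?K. finite (?S \<kappa>)"
      by (auto intro!: finite_ssyt_cont finite_young_diagram simp: horizontal_strip_def)
  qed
  finally show ?thesis by (simp add: kostka_def)
qed

text \<open>On the right, \<open>f\<close> runs over exponents of the complete homogeneous function
  of degree \<open>n\<close>, so this is Pieri's rule at the coefficient \<open>e\<close>. The
  induction on the bound \<open>N\<close> of the letters takes the strip of letters
  \<open>Suc N\<close> off \<rho>, commutes it with the strip on \<mu> and applies the hypothesis to
  the smaller shape \<kappa>.\<close>

lemma pieri: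
  assumes "is_partition \<mu>" "\<And>m. e m \<noteq> 0 \<Longrightarrow> 1 \<le> m \<and> m \<le> N"
  shows "(\<Sum>\<rho> | horizontal_strip \<mu> \<rho> \<and> size_fun \<rho> = size_fun \<mu> + n. kostka \<rho> e) =
         (\<Sum>f | f \<le> e \<and> size_fun f = n. kostka \<mu> (e - f))"
  using assms
proof (induction N arbitrary: \<mu> e n)
  case 0
  then have e: "e = 0" by (auto simp: fun_eq_iff)
  have par0: "is_partition 0" by (simp add: is_partition_def)
  have "\<mu> = 0" if "horizontal_strip \<mu> 0"
    using horizontal_strip_le[OF that] by (auto simp: le_fun_def fun_eq_iff)
  moreover have "horizontal_strip 0 0"
    using par0 by (simp add: horizontal_strip_def)
  \<comment> \<open>Without letters only the empty shape contributes, and it is reached only from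
    \<open>\<mu> = 0\<close> with \<open>n = 0\<close>.\<close>
  ultimately have "(\<Sum>\<rho> | horizontal_strip \<mu> \<rho> \<and> size_fun \<rho> = size_fun \<mu> + n. kostka \<rho> 0) =
      (\<Sum>\<rho>\<in>(if \<mu> = 0 \<and> n = 0 then {0} else {}). kostka \<rho> 0)"
    by (intro sum.mono_neutral_right)
      (auto simp: finite_strips_above kostka_0 size_fun_0 horizontal_strip_partition split: if_splits)
  also have "\<dots> = (\<Sum>f\<in>(if n = 0 then {0} else {}). kostka \<mu> (0 - f))"
    using kostka_0[OF 0(1)] kostka_0[OF par0] by (simp only: diff_zero split: if_split) simp
  also have "(if n = 0 then {0} else {}) = {f. f \<le> (0 :: nat \<Rightarrow> nat) \<and> size_fun f = n}"
  proof -
    have "f \<le> (0 :: nat \<Rightarrow> nat) \<longleftrightarrow> f = 0" for f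
      by (auto simp: le_fun_def fun_eq_iff)
    then show ?thesis by (auto simp: size_fun_0)
  qed
  finally show ?case unfolding e .
next
  case (Suc N)
  let ?d = "e (Suc N)" and ?e = "e(Suc N := 0)"
  let ?F = "\<lambda>k. {f. f \<le> ?e \<and> size_fun f = n - k}"
  have supp: "e m = 0" if "Suc N < m" for m
    using Suc.prems(2)[of m] that by (cases "e m = 0") auto
  have "{m. e m \<noteq> 0} \<subseteq> {..Suc N}"
    using supp by (auto simp del: not_le simp flip: not_less)
  then have fine: "finite {m. e m \<noteq> 0}" using finite_subset by blast
  then have "finite {m. ?e m \<noteq> 0}"
    by (rule finite_subset[rotated]) auto
  then have finF: "finite {f. f \<le> ?e}"
    by (rule finite_functions_le)
  have F: "f (Suc N) = 0" "finite {m. f m \<noteq> 0}" if "f \<in> ?F k" for f k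
  proof -
    have le: "f m \<le> ?e m" for m using that by (simp add: le_fun_def)
    show "f (Suc N) = 0" using le[of "Suc N"] by simp
    show "finite {m. f m \<noteq> 0}"
      using \<open>finite {m. ?e m \<noteq> 0}\<close> le by (intro finite_support_le[of f ?e] le_funI)
  qed
  have "(\<Sum>\<rho> | horizontal_strip \<mu> \<rho> \<and> size_fun \<rho> = size_fun \<mu> + n. kostka \<rho> e) =
     (\<Sum>\<rho> | horizontal_strip \<mu> \<rho> \<and> size_fun \<rho> = size_fun \<mu> + n.
        \<Sum>\<nu> | horizontal_strip \<nu> \<rho> \<and> size_fun \<nu> + ?d = size_fun \<rho>. kostka \<nu> ?e)"
    by (intro sum.cong refl kostka_remove_strip) (auto simp: horizontal_strip_def supp)
  also have "\<dots> = (\<Sum>k\<le>min n ?d. \<Sum>\<kappa> | horizontal_strip \<kappa> \<mu> \<and> size_fun \<kappa> + (?d - k) = size_fun \<mu>.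
            \<Sum>\<nu> | horizontal_strip \<kappa> \<nu> \<and> size_fun \<nu> = size_fun \<kappa> + (n - k). kostka \<nu> ?e)"
    by (rule strip_commutation[OF Suc.prems(1)])
  also have "\<dots> = (\<Sum>k\<le>min n ?d. \<Sum>\<kappa> | horizontal_strip \<kappa> \<mu> \<and> size_fun \<kappa> + (?d - k) = size_fun \<mu>.
            \<Sum>f\<in>?F k. kostka \<kappa> (?e - f))"
    by (intro sum.cong refl Suc.IH) (use Suc.prems(2) in \<open>auto simp: horizontal_strip_def le_Suc_eq split: if_splits\<close>)
  also have "\<dots> = (\<Sum>k\<le>min n ?d. \<Sum>f\<in>?F k. \<Sum>\<kappa> | horizontal_strip \<kappa> \<mu> \<and> size_fun \<kappa> + (?d - k) = size_fun \<mu>.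
            kostka \<kappa> (?e - f))"
    by (intro sum.cong refl sum.swap)
  \<comment> \<open>Now \<open>k\<close> acts as the exponent of the letter \<open>Suc N\<close> in
    the monomial of degree \<open>n\<close>. The other \<open>?d - k\<close> copies of this letter
    form the strip between \<kappa> and \<mu>, which \<open>kostka_remove_strip\<close> puts
    back.\<close>
  also have "\<dots> = (\<Sum>k\<le>min n ?d. \<Sum>f\<in>?F k. kostka \<mu> (e - f(Suc N := k)))"
  proof (intro sum.cong refl)
    fix k f assume k: "k \<in> {..min n ?d}" and f: "f \<in> ?F k"
    have "kostka \<mu> (e - f(Suc N := k)) =
      (\<Sum>\<kappa> | horizontal_strip \<kappa> \<mu> \<and> size_fun \<kappa> + (e - f(Suc N := k)) (Suc N) = size_fun \<mu>.
         kostka \<kappa> ((e - f(Suc N := k))(Suc N := 0)))"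
      by (rule kostka_remove_strip[OF Suc.prems(1)]) (simp add: supp)
    moreover have "(e - f(Suc N := k))(Suc N := 0) = ?e - f"
      using F[OF f] by (auto simp: fun_eq_iff)
    ultimately show "(\<Sum>\<kappa> | horizontal_strip \<kappa> \<mu> \<and> size_fun \<kappa> + (?d - k) = size_fun \<mu>. kostka \<kappa> (?e - f)) =
       kostka \<mu> (e - f(Suc N := k))"
      by simp
  qed
  also have "\<dots> = (\<Sum>(k, f)\<in>(SIGMA k:{..min n ?d}. ?F k). kostka \<mu> (e - f(Suc N := k)))"
    by (rule sum.Sigma) (auto intro: finite_subset[OF _ finF])
  \<comment> \<open>An exponent function below \<open>e\<close> splits uniquely into its value
    \<open>k\<close> at \<open>Suc N\<close> and a function that vanishes there.\<close>
  also have "\<dots> = (\<Sum>f | f \<le> e \<and> size_fun f = n. kostka \<mu> (e - f))"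
  proof (rule sum.reindex_bij_witness[where j = "\<lambda>(k, f). f(Suc N := k)"
        and i = "\<lambda>f. (f (Suc N), f(Suc N := 0))"])
    have size: "size_fun (f(Suc N := k)) = k + size_fun f" if "f (Suc N) = 0" "finite {m. f m \<noteq> 0}" for f k
    proof -
      have "f(Suc N := k) = f + (0 :: nat \<Rightarrow> nat)(Suc N := k)"
        using that by (auto simp: fun_eq_iff)
      moreover have "size_fun ((0 :: nat \<Rightarrow> nat)(Suc N := k)) = k"
      proof (cases "k = 0")
        case False
        then have "{m. ((0 :: nat \<Rightarrow> nat)(Suc N := k)) m \<noteq> 0} = {Suc N}" by auto
        then show ?thesis unfolding size_fun_def by simp
      qed (simp add: size_fun_0[unfolded zero_fun_def] size_fun_def)
      ultimately show ?thesis
        using that(2) by (simp add: size_fun_add)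
    qed
    {
      fix x assume "x \<in> (SIGMA k:{..min n ?d}. ?F k)"
      then obtain k f where x: "x = (k, f)" "k \<le> n" "k \<le> ?d" "f \<in> ?F k" by auto
      note f = F[OF x(4)]
      show "(case x of (k, f) \<Rightarrow> f(Suc N := k)) \<in> {f. f \<le> e \<and> size_fun f = n}"
        using x size[OF f, of k] by (auto simp: le_fun_def split: if_splits)
      show "((case x of (k, f) \<Rightarrow> f(Suc N := k)) (Suc N), (case x of (k, f) \<Rightarrow> f(Suc N := k))(Suc N := 0)) = x"
        using x f by (auto simp: fun_eq_iff)
      show "kostka \<mu> (e - (case x of (k, f) \<Rightarrow> f(Suc N := k))) = (case x of (k, f) \<Rightarrow> kostka \<mu> (e - f(Suc N := k)))"
        using x by simp
    }
    fix f assume f: "f \<in> {f. f \<le> e \<and> size_fun f = n}"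
    show "(case (f (Suc N), f(Suc N := 0)) of (k, f) \<Rightarrow> f(Suc N := k)) = f" by simp
    have "finite {m. f m \<noteq> 0}"
      using fine f by (intro finite_support_le[of f e]) auto
    then have "finite {m. (f(Suc N := 0)) m \<noteq> 0}"
      by (rule finite_subset[rotated]) auto
    then have "n = f (Suc N) + size_fun (f(Suc N := 0))"
      using size[of "f(Suc N := 0)" "f (Suc N)"] f by simp
    then show "(f (Suc N), f(Suc N := 0)) \<in> (SIGMA k:{..min n ?d}. ?F k)"
      using f by (auto simp: le_fun_def)
  qed
  finally show ?case .
qed

subsection \<open>Lattice words\<close>

definition words :: "nat \<Rightarrow> nat list set" where
  "words n = {w. length w = n \<and> 0 \<notin> set w}"

definition decreasing_words :: "nat \<Rightarrow> nat list set" where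
  "decreasing_words n = {w \<in> words n. sorted_wrt (\<ge>) w}"

text \<open>These words continue a lattice word of content \<mu>. The empty prefix is included, so
  \<mu> itself must decrease from index 1 on; \<open>lattice_from \<mu> []\<close> expresses just
  that.\<close>

definition lattice_from :: "(nat \<Rightarrow> nat) \<Rightarrow> nat list \<Rightarrow> bool" where
  "lattice_from \<mu> w \<longleftrightarrow> (\<forall>n\<le>length w. \<forall>m\<ge>1.
     \<mu> (m + 1) + count_list (take n w) (m + 1) \<le> \<mu> m + count_list (take n w) m)"

lemma lattice_word_from_0: "lattice_word w \<longleftrightarrow> lattice_from 0 w"
  by (simp add: lattice_word_def lattice_from_def)

lemma lattice_from_take:
  assumes "lattice_from \<mu> w" "n \<le> length w" "1 \<le> m"
  shows "\<mu> (m + 1) + count_list (take n w) (m + 1) \<le> \<mu> m + count_list (take n w) m"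
  using assms unfolding lattice_from_def by blast

lemma lattice_from_Nil: "is_partition \<mu> \<Longrightarrow> lattice_from \<mu> []"
  by (simp add: lattice_from_def is_partition_def)

lemma count_list_append_fun: "count_list (u @ v) = count_list u + count_list v"
  by (simp add: fun_eq_iff)

lemma lattice_from_append:
  "lattice_from \<mu> (u @ v) \<longleftrightarrow> lattice_from \<mu> u \<and> lattice_from (\<mu> + count_list u) v" (is "?l \<longleftrightarrow> ?r")
proof
  assume l: ?l
  show ?r
    unfolding lattice_from_def
  proof (intro conjI allI impI)
    fix n m :: nat assume "n \<le> length u" "1 \<le> m"
    then show "\<mu> (m + 1) + count_list (take n u) (m + 1) \<le> \<mu> m + count_list (take n u) m"
      using lattice_from_take[OF l, of n m] by simp
  next
    fix n m :: nat assume "n \<le> length v" "1 \<le> m"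
    then show "(\<mu> + count_list u) (m + 1) + count_list (take n v) (m + 1)
       \<le> (\<mu> + count_list u) m + count_list (take n v) m"
      using lattice_from_take[OF l, of "length u + n" m] by (simp add: ac_simps)
  qed
next
  assume r: ?r
  show ?l
    unfolding lattice_from_def
  proof (intro allI impI)
    fix n m :: nat assume n: "n \<le> length (u @ v)" "1 \<le> m"
    show "\<mu> (m + 1) + count_list (take n (u @ v)) (m + 1) \<le> \<mu> m + count_list (take n (u @ v)) m"
    proof (cases "n \<le> length u")
      case True
      then show ?thesis using r n unfolding lattice_from_def by auto
    next
      case False
      then have "n - length u \<le> length v" using n by simp
      then have "(\<mu> + count_list u) (m + 1) + count_list (take (n - length u) v) (m + 1)
         \<le> (\<mu> + count_list u) m + count_list (take (n - length u) v) m"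
        using r n unfolding lattice_from_def by blast
      then show ?thesis using False by (simp add: ac_simps)
    qed
  qed
qed

lemma is_partition_add_count:
  assumes "is_partition \<mu>" "lattice_from \<mu> w" "0 \<notin> set w"
  shows "is_partition (\<mu> + count_list w)"
proof -
  have "{m. (\<mu> + count_list w) m \<noteq> 0} \<subseteq> {m. \<mu> m \<noteq> 0} \<union> set w"
    by (auto simp: count_list_0_iff)
  then have "finite {m. (\<mu> + count_list w) m \<noteq> 0}"
    by (rule finite_subset) (use assms in \<open>auto simp: is_partition_def\<close>)
  moreover have "(\<mu> + count_list w) (Suc m) \<le> (\<mu> + count_list w) m" if "1 \<le> m" for m
    using lattice_from_take[OF assms(2), of "length w" m] that by simp
  ultimately show ?thesis
    using assms by (simp add: is_partition_def count_list_0_iff)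
qed

text \<open>In a weakly decreasing word every \<open>m + 1\<close> precedes every \<open>m\<close>.
  The worst prefix consists of the letters above \<open>m\<close>: it contains all
  \<open>m + 1\<close> and no \<open>m\<close>.\<close>

lemma lattice_from_decreasing:
  assumes "sorted_wrt (\<ge>) w"
  shows "lattice_from \<mu> w \<longleftrightarrow> lattice_from \<mu> [] \<and> (\<forall>m\<ge>1. \<mu> (m + 1) + count_list w (m + 1) \<le> \<mu> m)"
    (is "?l \<longleftrightarrow> ?r")
proof
  assume l: ?l
  have "\<mu> (m + 1) + count_list w (m + 1) \<le> \<mu> m" if "1 \<le> m" for m
  proof -
    let ?p = "takeWhile (\<lambda>x. m < x) w" and ?q = "dropWhile (\<lambda>x. m < x) w"
    have "m + 1 \<notin> set ?q"
      using assms by (induction w) auto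
    moreover have "m \<notin> set ?p"
      by (auto dest: set_takeWhileD)
    moreover have "count_list w x = count_list ?p x + count_list ?q x" for x
      by (metis count_list_append takeWhile_dropWhile_id)
    moreover have "\<mu> (m + 1) + count_list ?p (m + 1) \<le> \<mu> m + count_list ?p m"
      using l that unfolding lattice_from_def
      by (metis length_takeWhile_le takeWhile_eq_take)
    ultimately show ?thesis
      by (simp add: count_notin)
  qed
  moreover have "lattice_from \<mu> []"
    using l lattice_from_append[of \<mu> "[]" w] by simp
  ultimately show ?r by blast
next
  assume r: ?r
  show ?l
    unfolding lattice_from_def
  proof (intro allI impI)
    fix n m :: nat assume "1 \<le> m"
    have "count_list (take n w) (m + 1) \<le> count_list w (m + 1)"
      by (metis append_take_drop_id count_list_append le_add1)
    then show "\<mu> (m + 1) + count_list (take n w) (m + 1) \<le> \<mu> m + count_list (take n w) m"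
      using r \<open>1 \<le> m\<close> by (meson add_left_mono le_add1 le_trans)
  qed
qed

text \<open>If each letter \<open>m\<close> becomes a new cell in row \<open>m\<close>, the
  inequality of \<open>lattice_from_decreasing\<close> is the half of the interlacing condition that
  is not automatic.\<close>

lemma lattice_from_decreasing_strip:
  assumes "is_partition \<mu>" "w \<in> decreasing_words n"
  shows "lattice_from \<mu> w \<longleftrightarrow> horizontal_strip \<mu> (\<mu> + count_list w)"
proof -
  have "lattice_from \<mu> w \<longleftrightarrow> (\<forall>m\<ge>1. \<mu> (m + 1) + count_list w (m + 1) \<le> \<mu> m)"
    using assms lattice_from_decreasing[of w \<mu>] by (simp add: decreasing_words_def lattice_from_Nil)
  moreover have "is_partition (\<mu> + count_list w)" if "lattice_from \<mu> w"
    using assms that by (intro is_partition_add_count) (auto simp: decreasing_words_def words_def)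
  ultimately show ?thesis
    using assms(1) by (auto simp: horizontal_strip_def)
qed

lemma size_fun_count_list: "size_fun (count_list w) = length w"
  unfolding size_fun_def
  using sum_count_set[of w "set w"] by (simp add: count_list_0_iff)

lemma finite_support_count_list: "finite {m. count_list w m \<noteq> 0}"
  by (rule finite_subset[of _ "set w"]) (auto simp: count_list_0_iff)

lemma count_list_count_mset: "count_list w = count (mset w)"
  by (induction w) (auto simp: fun_eq_iff)

lemma inj_on_count_decreasing: "inj_on count_list (decreasing_words n)"
proof (rule inj_onI)
  fix v w assume "v \<in> decreasing_words n" "w \<in> decreasing_words n" "count_list v = count_list w"
  then have "mset (rev v) = mset (rev w)" "sorted (rev v)" "sorted (rev w)"
    by (auto simp: count_list_count_mset count_inject decreasing_words_def sorted_wrt_rev)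
  then show "v = w"
    by (metis properties_for_sort rev_rev_ident)
qed

text \<open>A weakly decreasing word is a sorted multiset of letters, so these contents are the
  exponents of the complete homogeneous function of degree \<open>n\<close>.\<close>

lemma count_decreasing_image:
  "count_list ` decreasing_words n = {f. f 0 = 0 \<and> finite {m. f m \<noteq> 0} \<and> size_fun f = n}" (is "?l = ?r")
proof
  show "?l \<subseteq> ?r"
    using finite_support_count_list
    by (auto simp: decreasing_words_def words_def size_fun_count_list count_list_0_iff simp del: neq0_conv)
  show "?r \<subseteq> ?l"
  proof
    fix f assume f: "f \<in> ?r"
    let ?w = "rev (sorted_list_of_multiset (Abs_multiset f))"
    have "count (Abs_multiset f) = f"
      using f by (intro count_Abs_multiset) (simp add: neq0_conv[symmetric] del: neq0_conv)
    then have c: "count_list ?w = f"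
      by (simp add: count_list_count_mset)
    have "length ?w = n"
      using f size_fun_count_list[of ?w] c by simp
    moreover have "0 \<notin> set ?w"
      using f c count_list_0_iff[of ?w 0] by simp
    moreover have "sorted_wrt (\<ge>) ?w"
      by (simp add: sorted_wrt_rev)
    ultimately have "?w \<in> decreasing_words n"
      by (simp add: decreasing_words_def words_def)
    then show "f \<in> ?l" using c by force
  qed
qed

text \<open>The identity of series is read at one coefficient \<open>e\<close>. Asking for it at
  every \<mu> allows the second factor of a concatenation to start from \<mu> plus the content of
  the first.\<close>

definition schur_expansion :: "nat list set \<Rightarrow> bool" where
  "schur_expansion X \<longleftrightarrow> (\<forall>\<mu> e. is_partition \<mu> \<longrightarrow> finite {m. e m \<noteq> 0} \<longrightarrow> e 0 = 0 \<longrightarrow>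
     (\<Sum>w | w \<in> X \<and> lattice_from \<mu> w. kostka (\<mu> + count_list w) e) =
     (\<Sum>w | w \<in> X \<and> count_list w \<le> e. kostka \<mu> (e - count_list w)))"

text \<open>Both sides of \<open>pieri\<close> are reindexed by decreasing words: the shapes as
  \<open>\<mu> + count_list w\<close>, the exponents as \<open>count_list w\<close>.\<close>

lemma schur_expansion_decreasing: "schur_expansion (decreasing_words n)"
  unfolding schur_expansion_def
proof (intro allI impI)
  fix \<mu> e :: "nat \<Rightarrow> nat"
  assume \<mu>: "is_partition \<mu>" and e: "finite {m. e m \<noteq> 0}" "e 0 = 0"
  let ?D = "decreasing_words n"
  obtain N where N: "\<And>m. N < m \<Longrightarrow> e m = 0"
    using e(1) finite_support_bound by blast
  have supp: "1 \<le> m \<and> m \<le> N" if "e m \<noteq> 0" for m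
    using that N[of m] e(2) by (cases "m = 0") (auto simp: not_less[symmetric])
  have fin\<mu>: "finite {m. \<mu> m \<noteq> 0}"
    using \<mu> by (simp add: is_partition_def)
  have "(\<lambda>w. \<mu> + count_list w) ` {w. w \<in> ?D \<and> lattice_from \<mu> w} =
     {\<rho>. horizontal_strip \<mu> \<rho> \<and> size_fun \<rho> = size_fun \<mu> + n}" (is "?l = ?r")
  proof
    show "?l \<subseteq> ?r"
    proof clarsimp
      fix w assume w: "w \<in> ?D" "lattice_from \<mu> w"
      then have "length w = n" by (simp add: decreasing_words_def words_def)
      then show "horizontal_strip \<mu> (\<mu> + count_list w) \<and> size_fun (\<mu> + count_list w) = size_fun \<mu> + n"
        using w lattice_from_decreasing_strip[OF \<mu> w(1)]
        using size_fun_add[OF fin\<mu> finite_support_count_list, of w]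
        by (simp add: size_fun_count_list)
    qed
    show "?r \<subseteq> ?l"
    proof
      fix \<rho> assume \<rho>: "\<rho> \<in> ?r"
      then have le: "\<mu> \<le> \<rho>" by (auto simp: horizontal_strip_le)
      have fin\<rho>: "finite {m. \<rho> m \<noteq> 0}"
        using \<rho> by (simp add: horizontal_strip_def is_partition_def)
      have eq: "\<rho> = \<mu> + (\<rho> - \<mu>)"
        using le by (auto simp: fun_eq_iff le_fun_def)
      have fin: "finite {m. (\<rho> - \<mu>) m \<noteq> 0}"
        by (rule finite_support_le[OF _ fin\<rho>]) (simp add: le_fun_def)
      have "size_fun \<rho> = size_fun \<mu> + size_fun (\<rho> - \<mu>)"
        unfolding size_fun_add[OF fin\<mu> fin, symmetric] by (rule arg_cong[OF eq])
      then have "size_fun (\<rho> - \<mu>) = n" using \<rho> by simp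
      moreover have "(\<rho> - \<mu>) 0 = 0"
        using \<rho> by (simp add: horizontal_strip_def is_partition_def)
      ultimately have "\<rho> - \<mu> \<in> count_list ` ?D"
        unfolding count_decreasing_image using fin by blast
      then obtain w where w: "w \<in> ?D" "count_list w = \<rho> - \<mu>" by auto
      then have "lattice_from \<mu> w"
        using lattice_from_decreasing_strip[OF \<mu> w(1)] \<rho> eq by simp
      then show "\<rho> \<in> ?l"
        using w eq by (intro image_eqI[of _ _ w]) auto
    qed
  qed
  moreover have "inj_on (\<lambda>w. \<mu> + count_list w) {w. w \<in> ?D \<and> lattice_from \<mu> w}"
    using inj_on_count_decreasing[of n] by (auto simp: inj_on_def)
  ultimately have "(\<Sum>w | w \<in> ?D \<and> lattice_from \<mu> w. kostka (\<mu> + count_list w) e) =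
      (\<Sum>\<rho> | horizontal_strip \<mu> \<rho> \<and> size_fun \<rho> = size_fun \<mu> + n. kostka \<rho> e)"
    by (subst sum.reindex[symmetric, unfolded o_def, of "\<lambda>w. \<mu> + count_list w" _ "\<lambda>\<rho>. kostka \<rho> e"]) simp_all
  also have "\<dots> = (\<Sum>f | f \<le> e \<and> size_fun f = n. kostka \<mu> (e - f))"
    by (rule pieri[OF \<mu> supp])
  also have "\<dots> = (\<Sum>w | w \<in> ?D \<and> count_list w \<le> e. kostka \<mu> (e - count_list w))"
  proof (rule sum.reindex_cong[of count_list])
    show "inj_on count_list {w. w \<in> ?D \<and> count_list w \<le> e}"
      by (rule inj_on_subset[OF inj_on_count_decreasing[of n]]) auto
    have "f 0 = 0 \<and> finite {m. f m \<noteq> 0}" if "f \<le> e" for f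
      using that e finite_support_le[OF that e(1)] by (auto simp: le_fun_def) (metis le_zero_eq)
    then have "{f. f \<le> e \<and> size_fun f = n} = {f \<in> count_list ` ?D. f \<le> e}"
      unfolding count_decreasing_image by blast
    then show "{f. f \<le> e \<and> size_fun f = n} = count_list ` {w. w \<in> ?D \<and> count_list w \<le> e}"
      by auto
  qed auto
  finally show "(\<Sum>w | w \<in> ?D \<and> lattice_from \<mu> w. kostka (\<mu> + count_list w) e) =
     (\<Sum>w | w \<in> ?D \<and> count_list w \<le> e. kostka \<mu> (e - count_list w))" .
qed

text \<open>A letter above \<open>L + 1\<close> requires its predecessor earlier in the word, so
  each position raises the largest possible letter by at most one. This makes the sums over lattice
  words finite although the alphabet is infinite.\<close>

lemma lattice_from_letters:
  assumes "lattice_from \<mu> w" "\<And>m. L < m \<Longrightarrow> \<mu> m = 0" "x \<in> set w"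
  shows "x \<le> L + length w"
  using assms(1,3)
proof (induction w arbitrary: x rule: rev_induct)
  case (snoc y w)
  then have IH: "z \<le> L + length w" if "z \<in> set w" for z
    using that lattice_from_append[of \<mu> w "[y]"] by blast
  show ?case
  proof (rule ccontr)
    assume x: "\<not> x \<le> L + length (w @ [y])"
    then have "x \<notin> set w" using IH[of x] by auto
    then have xy: "x = y" using snoc.prems by simp
    define m where "m = x - 1"
    have m: "x = m + 1" "1 \<le> m" "L + length w < m"
      using x by (auto simp: m_def)
    then have "m \<notin> set (w @ [y])" "\<mu> m = 0"
      using IH[of m] xy assms(2) by auto
    moreover have "\<mu> (m + 1) + count_list (w @ [y]) (m + 1) \<le> \<mu> m + count_list (w @ [y]) m"
      using lattice_from_take[OF snoc.prems(1), of "length (w @ [y])" m] m(2) by simp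
    moreover have "0 < count_list (w @ [y]) (m + 1)"
      using xy m(1) by simp
    ultimately show False by (simp add: count_notin)
  qed
qed simp

lemma finite_lattice_words:
  assumes "is_partition \<mu>"
  shows "finite {w \<in> words n. lattice_from \<mu> w}"
proof -
  obtain L where L: "\<And>m. L < m \<Longrightarrow> \<mu> m = 0"
    using assms finite_support_bound unfolding is_partition_def by blast
  have "{w \<in> words n. lattice_from \<mu> w} \<subseteq> {w. set w \<subseteq> {..L + n} \<and> length w = n}"
    using lattice_from_letters[OF _ L] by (auto simp: words_def)
  then show ?thesis
    by (rule finite_subset) (simp add: finite_lists_length_eq)
qed

lemma finite_words_below:
  assumes "finite {m. e m \<noteq> (0::nat)}"
  shows "finite {w \<in> words n. count_list w \<le> e}"
proof -
  have "{w \<in> words n. count_list w \<le> e} \<subseteq> {w. set w \<subseteq> {m. e m \<noteq> 0} \<and> length w = n}"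
  proof clarsimp
    fix w x assume w: "w \<in> words n" "count_list w \<le> e"
    have "0 < e x" if "x \<in> set w" for x
    proof -
      have "0 < count_list w x" using that by (metis count_list_0_iff gr0I)
      then show ?thesis using w(2) by (meson le_fun_def less_le_trans)
    qed
    then show "set w \<subseteq> {m. 0 < e m} \<and> length w = n"
      using w(1) by (auto simp: words_def)
  qed
  then show ?thesis
    by (rule finite_subset) (use assms in \<open>simp add: finite_lists_length_eq\<close>)
qed

text \<open>For fixed \<open>u\<close>, the expansion of \<open>Y\<close> is used at
  \<open>\<mu> + count_list u\<close>; after exchanging the sums, that of \<open>X\<close> is used
  at the exponent \<open>e - count_list v\<close>. The common length \<open>p\<close> makes the
  factorization of a word unique.\<close>

lemma schur_expansion_append:
  assumes X: "X \<subseteq> words p" "schur_expansion X" and Y: "Y \<subseteq> words q" "schur_expansion Y"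
  shows "schur_expansion {u @ v | u v. u \<in> X \<and> v \<in> Y}"
  unfolding schur_expansion_def
proof (intro allI impI)
  fix \<mu> e :: "nat \<Rightarrow> nat"
  assume \<mu>: "is_partition \<mu>" and e: "finite {m. e m \<noteq> 0}" "e 0 = 0"
  let ?XY = "{u @ v | u v. u \<in> X \<and> v \<in> Y}"
  have lenX: "length u = p" if "u \<in> X" for u
    using that X by (auto simp: words_def)
  have par: "is_partition (\<mu> + count_list u)" if "u \<in> X" "lattice_from \<mu> u" for u
    using that X by (intro is_partition_add_count[OF \<mu>]) (auto simp: words_def)
  have fine: "finite {m. (e - f) m \<noteq> 0}" "(e - f) 0 = 0" for f
    using finite_support_le[OF _ e(1), of "e - f"] e(2) by (auto simp: le_fun_def)
  have finX: "finite {u. u \<in> X \<and> lattice_from \<nu> u}" if "is_partition \<nu>" for \<nu>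
    using finite_lattice_words[OF that, of p] by (rule finite_subset[rotated]) (use X in auto)
  have finY: "finite {u. u \<in> Y \<and> lattice_from \<nu> u}" if "is_partition \<nu>" for \<nu>
    using finite_lattice_words[OF that, of q] by (rule finite_subset[rotated]) (use Y in auto)
  have finX': "finite {u. u \<in> X \<and> count_list u \<le> f}" if "finite {m. f m \<noteq> 0}" for f
    using finite_words_below[OF that, of p] by (rule finite_subset[rotated]) (use X in auto)
  have finY': "finite {u. u \<in> Y \<and> count_list u \<le> f}" if "finite {m. f m \<noteq> 0}" for f
    using finite_words_below[OF that, of q] by (rule finite_subset[rotated]) (use Y in auto)
  let ?S = "SIGMA u:{u. u \<in> X \<and> lattice_from \<mu> u}. {v. v \<in> Y \<and> lattice_from (\<mu> + count_list u) v}"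
  let ?S' = "SIGMA v:{v. v \<in> Y \<and> count_list v \<le> e}. {u. u \<in> X \<and> count_list u \<le> e - count_list v}"
  have "(\<Sum>w | w \<in> ?XY \<and> lattice_from \<mu> w. kostka (\<mu> + count_list w) e) =
     (\<Sum>(u, v)\<in>?S. kostka (\<mu> + count_list u + count_list v) e)"
  proof (rule sum.reindex_cong[of "\<lambda>(u, v). u @ v"])
    show "inj_on (\<lambda>(u, v). u @ v) ?S"
      using lenX by (auto simp: inj_on_def)
    show "{w. w \<in> ?XY \<and> lattice_from \<mu> w} = (\<lambda>(u, v). u @ v) ` ?S"
      by (auto simp: lattice_from_append image_iff)
  qed (auto simp: count_list_append_fun add.assoc)
  also have "\<dots> = (\<Sum>u | u \<in> X \<and> lattice_from \<mu> u. \<Sum>v | v \<in> Y \<and> lattice_from (\<mu> + count_list u) v.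
      kostka (\<mu> + count_list u + count_list v) e)"
    by (rule sum.Sigma[symmetric]) (use finX[OF \<mu>] finY par in auto)
  also have "\<dots> = (\<Sum>u | u \<in> X \<and> lattice_from \<mu> u. \<Sum>v | v \<in> Y \<and> count_list v \<le> e.
      kostka (\<mu> + count_list u) (e - count_list v))"
    by (intro sum.cong refl Y(2)[unfolded schur_expansion_def, rule_format]) (use e par in auto)
  also have "\<dots> = (\<Sum>v | v \<in> Y \<and> count_list v \<le> e. \<Sum>u | u \<in> X \<and> lattice_from \<mu> u.
      kostka (\<mu> + count_list u) (e - count_list v))"
    by (rule sum.swap)
  also have "\<dots> = (\<Sum>v | v \<in> Y \<and> count_list v \<le> e. \<Sum>u | u \<in> X \<and> count_list u \<le> e - count_list v.
      kostka \<mu> (e - count_list v - count_list u))"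
    by (intro sum.cong refl X(2)[unfolded schur_expansion_def, rule_format] \<mu> fine)
  also have "\<dots> = (\<Sum>(v, u)\<in>?S'. kostka \<mu> (e - count_list v - count_list u))"
    by (rule sum.Sigma) (intro ballI finX' finY' fine(1) e(1))+
  also have "\<dots> = (\<Sum>w | w \<in> ?XY \<and> count_list w \<le> e. kostka \<mu> (e - count_list w))"
  proof (rule sum.reindex_cong[of "\<lambda>(v, u). u @ v", symmetric])
    show "inj_on (\<lambda>(v, u). u @ v) ?S'"
      using lenX by (auto simp: inj_on_def)
    have "count_list (u @ v) \<le> e \<longleftrightarrow> count_list v \<le> e \<and> count_list u \<le> e - count_list v" for u v
    proof
      assume a: "count_list (u @ v) \<le> e"
      have "count_list u m + count_list v m \<le> e m" for m
        using le_funD[OF a, of m] by simp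
      then show "count_list v \<le> e \<and> count_list u \<le> e - count_list v"
        by (auto simp: le_fun_def intro: add_leD2 add_le_imp_le_diff)
    next
      assume "count_list v \<le> e \<and> count_list u \<le> e - count_list v"
      then have "count_list v m \<le> e m" "count_list u m \<le> e m - count_list v m" for m
        by (auto simp: le_fun_def)
      then show "count_list (u @ v) \<le> e"
        by (auto simp: le_fun_def) (metis le_diff_conv2)
    qed
    then show "{w. w \<in> ?XY \<and> count_list w \<le> e} = (\<lambda>(v, u). u @ v) ` ?S'"
      by (force simp: image_iff)
    have "e - count_list v - count_list u = e - count_list (u @ v)" for u v
      by (auto simp: fun_eq_iff)
    then show "\<And>x. x \<in> ?S' \<Longrightarrow> kostka \<mu> (e - count_list (case x of (v, u) \<Rightarrow> u @ v)) =
        (case x of (v, u) \<Rightarrow> kostka \<mu> (e - count_list v - count_list u))"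
      by auto
  qed
  finally show "(\<Sum>w | w \<in> ?XY \<and> lattice_from \<mu> w. kostka (\<mu> + count_list w) e) =
     (\<Sum>w | w \<in> ?XY \<and> count_list w \<le> e. kostka \<mu> (e - count_list w))" .
qed

text \<open>All sums are finite and split over the disjoint union, so the identity for
  \<open>Y\<close> cancels from the one for the union, without any subtraction of naturals.\<close>

lemma schur_expansion_diff:
  assumes "schur_expansion (X \<union> Y)" "schur_expansion Y" "X \<inter> Y = {}" "X \<union> Y \<subseteq> words n"
  shows "schur_expansion X"
  unfolding schur_expansion_def
proof (intro allI impI)
  fix \<mu> e :: "nat \<Rightarrow> nat"
  assume \<mu>: "is_partition \<mu>" and e: "finite {m. e m \<noteq> 0}" "e 0 = 0"
  have split: "(\<Sum>w | w \<in> X \<union> Y \<and> P w. g w) = (\<Sum>w | w \<in> X \<and> P w. g w) + (\<Sum>w | w \<in> Y \<and> P w. g w)"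
    if "finite {w \<in> words n. P w}" for P and g :: "nat list \<Rightarrow> nat"
  proof -
    have "finite {w. w \<in> X \<and> P w}" "finite {w. w \<in> Y \<and> P w}"
      using that by (rule finite_subset[rotated]; use assms(4) in auto)+
    moreover have "{w. w \<in> X \<union> Y \<and> P w} = {w. w \<in> X \<and> P w} \<union> {w. w \<in> Y \<and> P w}"
      by auto
    ultimately show ?thesis
      using assms(3) by (simp only:) (rule sum.union_disjoint, auto)
  qed
  have "(\<Sum>w | w \<in> X \<union> Y \<and> lattice_from \<mu> w. kostka (\<mu> + count_list w) e) =
      (\<Sum>w | w \<in> X \<union> Y \<and> count_list w \<le> e. kostka \<mu> (e - count_list w))"
    "(\<Sum>w | w \<in> Y \<and> lattice_from \<mu> w. kostka (\<mu> + count_list w) e) =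
      (\<Sum>w | w \<in> Y \<and> count_list w \<le> e. kostka \<mu> (e - count_list w))"
    using assms(1,2) \<mu> e unfolding schur_expansion_def by blast+
  then show "(\<Sum>w | w \<in> X \<and> lattice_from \<mu> w. kostka (\<mu> + count_list w) e) =
      (\<Sum>w | w \<in> X \<and> count_list w \<le> e. kostka \<mu> (e - count_list w))"
    using split[OF finite_lattice_words[OF \<mu>], of "\<lambda>w. kostka (\<mu> + count_list w) e"]
      split[OF finite_words_below[OF e(1)], of "\<lambda>w. kostka \<mu> (e - count_list w)"] by linarith
qed

text \<open>Rows are read from right to left: \<open>last u\<close> is the leftmost entry of the
  first row, and \<open>hd v\<close> is the rightmost entry of the next row, directly below. The
  strict inequality is the column condition.\<close>

fun ribbon_words :: "nat list \<Rightarrow> nat list set" where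
  "ribbon_words [] = {[]}"
| "ribbon_words [a] = decreasing_words a"
| "ribbon_words (a # b # \<gamma>) = {u @ v | u v. u \<in> decreasing_words a \<and> v \<in> ribbon_words (b # \<gamma>) \<and> last u < hd v}"

lemma ribbon_words_subset: "ribbon_words \<gamma> \<subseteq> words (sum_list \<gamma>)"
proof (induction \<gamma> rule: ribbon_words.induct)
  case (3 a b \<gamma>)
  then have "length v = b + sum_list \<gamma> \<and> 0 \<notin> set v" if "v \<in> ribbon_words (b # \<gamma>)" for v
    using that by (auto simp: words_def)
  then show ?case
    by (auto simp: words_def decreasing_words_def)
qed (auto simp: words_def decreasing_words_def)

lemma sorted_wrt_ge_append_iff:
  fixes u v :: "nat list"
  assumes "u \<noteq> []" "v \<noteq> []"
  shows "sorted_wrt (\<ge>) (u @ v) \<longleftrightarrow> sorted_wrt (\<ge>) u \<and> sorted_wrt (\<ge>) v \<and> hd v \<le> last u"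
proof
  assume "sorted_wrt (\<ge>) u \<and> sorted_wrt (\<ge>) v \<and> hd v \<le> last u"
  moreover have "last u \<le> x" if "x \<in> set u" "sorted_wrt (\<ge>) u" for x
    using that by (induction u) auto
  moreover have "y \<le> hd v" if "y \<in> set v" "sorted_wrt (\<ge>) v" for y
    using that by (cases v) auto
  ultimately show "sorted_wrt (\<ge>) (u @ v)"
    unfolding sorted_wrt_append by (meson le_trans)
qed (use assms in \<open>auto simp: sorted_wrt_append\<close>)

lemma decreasing_words_add:
  assumes "1 \<le> a" "1 \<le> b"
  shows "decreasing_words (a + b) = {u @ v | u v. u \<in> decreasing_words a \<and> v \<in> decreasing_words b \<and> hd v \<le> last u}"
proof (intro equalityI subsetI)
  fix w assume w: "w \<in> decreasing_words (a + b)"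
  let ?u = "take a w" and ?v = "drop a w"
  have len: "length ?u = a" "length ?v = b"
    using w by (auto simp: decreasing_words_def words_def)
  then have "?u \<noteq> []" "?v \<noteq> []" using assms by auto
  then have "sorted_wrt (\<ge>) ?u \<and> sorted_wrt (\<ge>) ?v \<and> hd ?v \<le> last ?u"
    using w sorted_wrt_ge_append_iff[of ?u ?v] by (simp add: decreasing_words_def)
  then show "w \<in> {u @ v | u v. u \<in> decreasing_words a \<and> v \<in> decreasing_words b \<and> hd v \<le> last u}"
    using w len by (intro CollectI exI[of _ ?u] exI[of _ ?v])
      (auto simp: decreasing_words_def words_def dest: in_set_takeD in_set_dropD)
next
  fix w assume "w \<in> {u @ v | u v. u \<in> decreasing_words a \<and> v \<in> decreasing_words b \<and> hd v \<le> last u}"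
  then obtain u v where w: "w = u @ v" and uv: "u \<in> decreasing_words a" "v \<in> decreasing_words b" "hd v \<le> last u"
    by auto
  then have "u \<noteq> []" "v \<noteq> []"
    using assms by (auto simp: decreasing_words_def words_def)
  then show "w \<in> decreasing_words (a + b)"
    using w uv sorted_wrt_ge_append_iff[of u v] by (auto simp: decreasing_words_def words_def)
qed

text \<open>When the column condition between them fails, \<open>u\<close> and the first row of
  \<open>v\<close> join into one weakly decreasing row.\<close>

lemma ribbon_words_merge:
  assumes "1 \<le> a" "1 \<le> b"
  shows "ribbon_words ((a + b) # \<gamma>) =
    {u @ v | u v. u \<in> decreasing_words a \<and> v \<in> ribbon_words (b # \<gamma>) \<and> hd v \<le> last u}"
proof (cases \<gamma>)
  case Nil
  then show ?thesis using decreasing_words_add[OF assms] by simp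
next
  case (Cons c \<delta>)
  have ne: "u \<noteq> []" if "u \<in> decreasing_words b" for u
    using that assms by (auto simp: decreasing_words_def words_def)
  show ?thesis
    unfolding Cons ribbon_words.simps decreasing_words_add[OF assms]
  proof (intro equalityI subsetI)
    fix w assume "w \<in> {u @ v | u v. u \<in> {u @ v | u v. u \<in> decreasing_words a \<and> v \<in> decreasing_words b \<and> hd v \<le> last u}
        \<and> v \<in> ribbon_words (c # \<delta>) \<and> last u < hd v}"
    then obtain u1 u2 v where *: "w = (u1 @ u2) @ v" "u1 \<in> decreasing_words a" "u2 \<in> decreasing_words b"
      "hd u2 \<le> last u1" "v \<in> ribbon_words (c # \<delta>)" "last (u1 @ u2) < hd v"
      by blast
    show "w \<in> {u @ v | u v. u \<in> decreasing_words a \<and>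
        v \<in> {u @ v | u v. u \<in> decreasing_words b \<and> v \<in> ribbon_words (c # \<delta>) \<and> last u < hd v} \<and> hd v \<le> last u}"
      using * ne[of u2] by (intro CollectI exI[of _ u1] exI[of _ "u2 @ v"]) auto
  next
    fix w assume "w \<in> {u @ v | u v. u \<in> decreasing_words a \<and>
        v \<in> {u @ v | u v. u \<in> decreasing_words b \<and> v \<in> ribbon_words (c # \<delta>) \<and> last u < hd v} \<and> hd v \<le> last u}"
    then obtain u1 u2 v where *: "w = u1 @ (u2 @ v)" "u1 \<in> decreasing_words a" "u2 \<in> decreasing_words b"
      "hd (u2 @ v) \<le> last u1" "v \<in> ribbon_words (c # \<delta>)" "last u2 < hd v"
      by blast
    show "w \<in> {u @ v | u v. u \<in> {u @ v | u v. u \<in> decreasing_words a \<and> v \<in> decreasing_words b \<and> hd v \<le> last u}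
        \<and> v \<in> ribbon_words (c # \<delta>) \<and> last u < hd v}"
      using * ne[of u2] by (intro CollectI exI[of _ "u1 @ u2"] exI[of _ v]) auto
  qed
qed

text \<open>The induction is on the number of rows, because both ribbons to which the hypothesis is
  applied, \<open>b # \<delta>\<close> and \<open>(a + b) # \<delta>\<close>, have one row
  less.\<close>

lemma schur_expansion_ribbon_words:
  assumes "\<forall>a\<in>set \<gamma>. 1 \<le> a" "\<gamma> \<noteq> []"
  shows "schur_expansion (ribbon_words \<gamma>)"
  using assms
proof (induction "length \<gamma>" arbitrary: \<gamma> rule: less_induct)
  case less
  show ?case
  proof (cases \<gamma> rule: ribbon_words.cases)
    case (3 a b \<delta>)
    let ?D = "decreasing_words a" and ?R = "ribbon_words (b # \<delta>)"
    have IH: "schur_expansion ?R" "schur_expansion (ribbon_words ((a + b) # \<delta>))"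
      using less 3 by auto
    have merge: "ribbon_words ((a + b) # \<delta>) = {u @ v | u v. u \<in> ?D \<and> v \<in> ?R \<and> hd v \<le> last u}"
      using less.prems 3 by (intro ribbon_words_merge) auto
    have D: "?D \<subseteq> words a"
      by (auto simp: decreasing_words_def)
    \<comment> \<open>At the level of words this is the product rule for ribbon Schur functions:
      concatenating two ribbons gives either the ribbon with rows \<open>a\<close>, \<open>b\<close>
      kept apart or the one with them merged.\<close>
    have union: "{u @ v | u v. u \<in> ?D \<and> v \<in> ?R} = ribbon_words (a # b # \<delta>) \<union> ribbon_words ((a + b) # \<delta>)"
      unfolding merge ribbon_words.simps by (auto simp flip: not_less)
    show ?thesis
      unfolding 3
    proof (rule schur_expansion_diff)
      show "schur_expansion (ribbon_words (a # b # \<delta>) \<union> ribbon_words ((a + b) # \<delta>))"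
        unfolding union[symmetric]
        by (rule schur_expansion_append[OF D schur_expansion_decreasing ribbon_words_subset IH(1)])
      show "ribbon_words (a # b # \<delta>) \<inter> ribbon_words ((a + b) # \<delta>) = {}"
      proof (rule equals0I)
        fix w assume "w \<in> ribbon_words (a # b # \<delta>) \<inter> ribbon_words ((a + b) # \<delta>)"
        then obtain u v u' v' where "w = u @ v" "last u < hd v" "w = u' @ v'" "hd v' \<le> last u'"
          and u: "u \<in> ?D" "u' \<in> ?D"
          unfolding merge ribbon_words.simps by blast
        \<comment> \<open>Both factorizations cut after \<open>a\<close> letters, hence coincide,
          and their inequalities contradict each other.\<close>
        moreover have "length u = length u'"
          using u D by (auto simp: words_def)
        ultimately show False by simp
      qed
      show "ribbon_words (a # b # \<delta>) \<union> ribbon_words ((a + b) # \<delta>) \<subseteq> words (a + b + sum_list \<delta>)"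
        using ribbon_words_subset[of "a # b # \<delta>"] ribbon_words_subset[of "(a + b) # \<delta>"] by (simp add: add.assoc)
    qed (rule IH(2))
  qed (use less.prems schur_expansion_decreasing in auto)
qed

lemma finite_support_cont:
  assumes "T \<in> ssyt D" "finite D"
  shows "finite {m. cont T m \<noteq> 0}"
proof (rule finite_subset)
  show "{m. cont T m \<noteq> 0} \<subseteq> (\<lambda>(r, c). T r c) ` D"
  proof
    fix m assume "m \<in> {m. cont T m \<noteq> 0}"
    then have "m \<noteq> 0" "{(r, c). T r c = m} \<noteq> {}"
      by (auto simp: cont_def split: if_splits intro: ccontr)
    then obtain r c where "T r c = m" "m \<noteq> 0" by auto
    then have "(r, c) \<in> D" using assms(1) by (auto simp: ssyt_def)
    then show "m \<in> (\<lambda>(r, c). T r c) ` D" using \<open>T r c = m\<close> by force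
  qed
qed (use assms(2) in simp)

text \<open>At \<open>\<mu> = 0\<close> the Schur factor is 1, so its coefficient at
  \<open>e - count_list w\<close> only tests whether \<open>w\<close> has content
  \<open>e\<close>.\<close>

lemma card_ribbon_words:
  assumes "\<forall>a\<in>set \<gamma>. 1 \<le> a" "\<gamma> \<noteq> []"
  shows "card {w \<in> ribbon_words \<gamma>. count_list w = e} =
    (\<Sum>w | w \<in> ribbon_words \<gamma> \<and> lattice_word w. kostka (count_list w) e)"
proof -
  have par0: "is_partition 0" by (simp add: is_partition_def)
  have words: "0 \<notin> set w" if "w \<in> ribbon_words \<gamma>" for w
    using that ribbon_words_subset[of \<gamma>] by (auto simp: words_def)
  have par: "is_partition (count_list w)" if "w \<in> ribbon_words \<gamma>" "lattice_word w" for w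
    using is_partition_add_count[OF par0] that words by (simp add: lattice_word_from_0)
  show ?thesis
  proof (cases "finite {m. e m \<noteq> 0} \<and> e 0 = 0")
    case True
    have "(\<Sum>w | w \<in> ribbon_words \<gamma> \<and> lattice_word w. kostka (count_list w) e) =
       (\<Sum>w | w \<in> ribbon_words \<gamma> \<and> lattice_from 0 w. kostka (0 + count_list w) e)"
      by (simp only: lattice_word_from_0 add_0_left)
    also have "\<dots> = (\<Sum>w | w \<in> ribbon_words \<gamma> \<and> count_list w \<le> e. kostka 0 (e - count_list w))"
      using schur_expansion_ribbon_words[OF assms] par0 True unfolding schur_expansion_def by blast
    also have "\<dots> = (\<Sum>w | w \<in> ribbon_words \<gamma> \<and> count_list w \<le> e. if count_list w = e then 1 else 0)"
    proof (intro sum.cong refl)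
      fix w assume w: "w \<in> {w. w \<in> ribbon_words \<gamma> \<and> count_list w \<le> e}"
      show "kostka 0 (e - count_list w) = (if count_list w = e then 1 else 0)"
      proof (cases "count_list w = e")
        case True
        then have "e - count_list w = 0" by simp
        then show ?thesis using True kostka_0[OF par0] by simp
      next
        case False
        have "young_diagram 0 = {}"
          by (auto simp: young_diagram_def)
        then have empty: "cont T = 0" if "T \<in> ssyt (young_diagram 0)" for T
          using that by (auto simp: ssyt_def cont_def fun_eq_iff not_less_eq_eq)
        have "e - count_list w \<noteq> 0"
        proof
          assume "e - count_list w = 0"
          then have "e m - count_list w m = 0" for m by (metis minus_apply zero_fun_apply)
          then show False using False w by (auto simp: fun_eq_iff le_fun_def intro: antisym)
        qed
        then have "{T \<in> ssyt (young_diagram 0). cont T = e - count_list w} = {}"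
          using empty by force
        then show ?thesis using False by (simp only: kostka_def card.empty if_False)
      qed
    qed
    also have "\<dots> = (\<Sum>w | w \<in> ribbon_words \<gamma> \<and> count_list w = e. 1)"
    proof (rule sum.mono_neutral_cong_right)
      show "finite {w. w \<in> ribbon_words \<gamma> \<and> count_list w \<le> e}"
        by (rule finite_subset[OF _ finite_words_below[of e "sum_list \<gamma>"]])
          (use True ribbon_words_subset[of \<gamma>] in auto)
    qed auto
    finally show ?thesis by simp
  next
    case False
    \<comment> \<open>An exponent with infinite support or with a nonzero value at 0 is the content
      of no tableau here and of no ribbon word, so both sides vanish.\<close>
    have "kostka (count_list w) e = 0" if "w \<in> ribbon_words \<gamma>" "lattice_word w" for w
    proof -
      have "cont T \<noteq> e" if "T \<in> ssyt (young_diagram (count_list w))" for T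
        using finite_support_cont[OF that finite_young_diagram[OF par]] False
          \<open>w \<in> ribbon_words \<gamma>\<close> \<open>lattice_word w\<close> by (auto simp: cont_def)
      then have "{T \<in> ssyt (young_diagram (count_list w)). cont T = e} = {}" by blast
      then show ?thesis by (simp only: kostka_def card.empty)
    qed
    then have zero: "(\<Sum>w | w \<in> ribbon_words \<gamma> \<and> lattice_word w. kostka (count_list w) e) = 0"
      by simp
    have "count_list w \<noteq> e" if "w \<in> ribbon_words \<gamma>" for w
      using words[OF that] False finite_support_count_list[of w] count_list_0_iff[of w 0] by blast
    then have "{w \<in> ribbon_words \<gamma>. count_list w = e} = {}" by blast
    then show ?thesis by (simp only: zero card.empty)
  qed
qed

subsection \<open>The Littlewood--Richardson rule for ribbons\<close>

text \<open>Item \<open>k\<close> of the list is row \<open>k + 1\<close> of the ribbon, from left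
  to right. So the column condition compares the first entry of a row with the last entry of the row
  below.\<close>

definition ribbon_rows :: "nat list \<Rightarrow> nat list list set" where
  "ribbon_rows \<gamma> = {rs. map length rs = \<gamma> \<and> (\<forall>k<length rs. sorted (rs ! k) \<and> 0 \<notin> set (rs ! k)) \<and>
     (\<forall>k. Suc k < length rs \<longrightarrow> hd (rs ! k) < last (rs ! Suc k))}"

definition word_of_rows :: "nat list list \<Rightarrow> nat list" where
  "word_of_rows rs = concat (map rev rs)"

definition row_list :: "nat list \<Rightarrow> (nat \<Rightarrow> nat \<Rightarrow> nat) \<Rightarrow> nat list list" where
  "row_list \<gamma> T = map (\<lambda>r. map (T r) [leftcol \<gamma> r..<leftcol \<gamma> r + part \<gamma> r]) [1..<Suc (length \<gamma>)]"

definition filling_of_rows :: "nat list \<Rightarrow> nat list list \<Rightarrow> nat \<Rightarrow> nat \<Rightarrow> nat" where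
  "filling_of_rows \<gamma> rs r c = (if (r, c) \<in> ribbon \<gamma> then rs ! (r - 1) ! (c - leftcol \<gamma> r) else 0)"

definition row_count :: "nat list list \<Rightarrow> nat \<Rightarrow> nat \<Rightarrow> nat" where
  "row_count rs k m = (\<Sum>l<k. count_list (rs ! l) m)"

lemma reading_word_rows: "reading_word \<gamma> T = word_of_rows (row_list \<gamma> T)"
  by (simp add: reading_word_def word_of_rows_def row_list_def o_def)

lemma length_row_list [simp]: "length (row_list \<gamma> T) = length \<gamma>"
  by (simp add: row_list_def del: upt_Suc)

lemma nth_row_list:
  "k < length \<gamma> \<Longrightarrow> row_list \<gamma> T ! k = map (T (Suc k)) [leftcol \<gamma> (Suc k)..<leftcol \<gamma> (Suc k) + \<gamma> ! k]"
  by (simp add: row_list_def part_def del: upt_Suc)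

lemma nth_row_list_nth:
  "k < length \<gamma> \<Longrightarrow> l < \<gamma> ! k \<Longrightarrow> row_list \<gamma> T ! k ! l = T (Suc k) (leftcol \<gamma> (Suc k) + l)"
  by (simp add: nth_row_list)

lemma length_nth_row_list: "k < length \<gamma> \<Longrightarrow> length (row_list \<gamma> T ! k) = \<gamma> ! k"
  by (simp add: nth_row_list)

lemma ribbon_Suc_iff:
  "(Suc k, c) \<in> ribbon \<gamma> \<longleftrightarrow> k < length \<gamma> \<and> leftcol \<gamma> (Suc k) \<le> c \<and> c < leftcol \<gamma> (Suc k) + \<gamma> ! k"
  by (auto simp: ribbon_def part_def)

lemma ribbon_row_pos: "(r, c) \<in> ribbon \<gamma> \<Longrightarrow> \<exists>k. r = Suc k"
  by (cases r) (auto simp: ribbon_def)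

lemma leftcol_overlap:
  assumes "\<forall>a\<in>set \<gamma>. 1 \<le> a" "Suc k < length \<gamma>"
  shows "leftcol \<gamma> (Suc (Suc k)) + \<gamma> ! Suc k = Suc (leftcol \<gamma> (Suc k))"
proof -
  have "1 \<le> \<gamma> ! Suc k" using assms by auto
  moreover have "leftcol \<gamma> (Suc (Suc k)) + \<gamma> ! Suc k - 1 = leftcol \<gamma> (Suc k)"
    using ribbon_overlap[of \<gamma> "Suc k"] assms by (simp add: part_def Suc_le_eq)
  ultimately show ?thesis by simp
qed

lemma hd_row_list:
  assumes "\<forall>a\<in>set \<gamma>. 1 \<le> a" "k < length \<gamma>"
  shows "hd (row_list \<gamma> T ! k) = T (Suc k) (leftcol \<gamma> (Suc k))"
proof -
  have "1 \<le> \<gamma> ! k" using assms by auto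
  then show ?thesis using assms(2) by (simp add: nth_row_list hd_map)
qed

lemma last_row_list:
  assumes "\<forall>a\<in>set \<gamma>. 1 \<le> a" "Suc k < length \<gamma>"
  shows "last (row_list \<gamma> T ! Suc k) = T (Suc (Suc k)) (leftcol \<gamma> (Suc k))"
proof -
  have "1 \<le> \<gamma> ! Suc k" using assms by auto
  then show ?thesis using assms(2) leftcol_overlap[OF assms] by (simp add: nth_row_list last_map)
qed

lemma row_list_in_ribbon_rows:
  assumes pos: "\<forall>a\<in>set \<gamma>. 1 \<le> a" and T: "T \<in> ssyt (ribbon \<gamma>)"
  shows "row_list \<gamma> T \<in> ribbon_rows \<gamma>"
proof -
  have cell: "(r, c) \<in> ribbon \<gamma> \<longleftrightarrow> 1 \<le> T r c" for r c
    using T by (auto simp: ssyt_def)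
  have row: "T r c \<le> T r c'" if "(r, c) \<in> ribbon \<gamma>" "(r, c') \<in> ribbon \<gamma>" "c \<le> c'" for r c c'
    using T that by (cases "c = c'") (auto simp: ssyt_def)
  have col: "T r c < T r' c" if "(r, c) \<in> ribbon \<gamma>" "(r', c) \<in> ribbon \<gamma>" "r < r'" for r r' c
    using T that by (auto simp: ssyt_def)
  have "map length (row_list \<gamma> T) = \<gamma>"
    by (rule nth_equalityI) (auto simp: length_nth_row_list)
  moreover have "sorted (row_list \<gamma> T ! k) \<and> 0 \<notin> set (row_list \<gamma> T ! k)" if k: "k < length \<gamma>" for k
  proof
    show "sorted (row_list \<gamma> T ! k)"
      unfolding sorted_iff_nth_mono using k
      by (auto simp: length_nth_row_list nth_row_list_nth ribbon_Suc_iff intro!: row)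
    have "1 \<le> T (Suc k) c" if "leftcol \<gamma> (Suc k) \<le> c" "c < leftcol \<gamma> (Suc k) + \<gamma> ! k" for c
      using that k cell[of "Suc k" c] by (simp add: ribbon_Suc_iff)
    then show "0 \<notin> set (row_list \<gamma> T ! k)"
      using k by (auto simp: nth_row_list image_iff Suc_le_eq)
  qed
  moreover have "hd (row_list \<gamma> T ! k) < last (row_list \<gamma> T ! Suc k)" if k: "Suc k < length \<gamma>" for k
  proof -
    have "1 \<le> \<gamma> ! k" "1 \<le> \<gamma> ! Suc k" using pos k by auto
    then have "(Suc k, leftcol \<gamma> (Suc k)) \<in> ribbon \<gamma>" "(Suc (Suc k), leftcol \<gamma> (Suc k)) \<in> ribbon \<gamma>"
      using k leftcol_overlap[OF pos k] by (auto simp: ribbon_Suc_iff)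
    then show ?thesis
      using k by (simp add: hd_row_list[OF pos] last_row_list[OF pos] col)
  qed
  ultimately show ?thesis
    by (simp add: ribbon_rows_def)
qed

lemma filling_of_rows_ssyt:
  assumes pos: "\<forall>a\<in>set \<gamma>. 1 \<le> a" and rs: "rs \<in> ribbon_rows \<gamma>"
  shows "filling_of_rows \<gamma> rs \<in> ssyt (ribbon \<gamma>)" "row_list \<gamma> (filling_of_rows \<gamma> rs) = rs"
proof -
  let ?T = "filling_of_rows \<gamma> rs"
  have len: "length rs = length \<gamma>"
    using rs by (auto simp: ribbon_rows_def)
  have rowlen: "length (rs ! k) = \<gamma> ! k" if "k < length \<gamma>" for k
    using rs that by (auto simp: ribbon_rows_def)
  have val: "?T (Suc k) (leftcol \<gamma> (Suc k) + l) = rs ! k ! l" if "k < length \<gamma>" "l < \<gamma> ! k" for k l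
    using that by (simp add: filling_of_rows_def ribbon_Suc_iff)
  show rl: "row_list \<gamma> ?T = rs"
  proof (rule nth_equalityI)
    fix k assume "k < length (row_list \<gamma> ?T)"
    then have k: "k < length \<gamma>" by simp
    show "row_list \<gamma> ?T ! k = rs ! k"
      by (rule nth_equalityI) (use k rowlen val in \<open>auto simp: length_nth_row_list nth_row_list_nth\<close>)
  qed (simp add: len)
  have sorted: "sorted (rs ! k)" "0 \<notin> set (rs ! k)" if "k < length \<gamma>" for k
    using rs that len by (auto simp: ribbon_rows_def)
  have chain: "hd (rs ! k) < last (rs ! Suc k)" if "Suc k < length \<gamma>" for k
    using rs that len by (auto simp: ribbon_rows_def)
  have down: "?T (Suc k) (leftcol \<gamma> (Suc k)) < ?T (Suc (Suc k)) (leftcol \<gamma> (Suc k))" if "Suc k < length \<gamma>" for k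
    using chain[OF that] hd_row_list[OF pos, of k ?T] last_row_list[OF pos that, of ?T] that rl by simp
  have antimono: "leftcol \<gamma> r' \<le> leftcol \<gamma> r" if "r \<le> r'" for r r'
    unfolding leftcol_def using that by (intro add_left_mono sum_mono2) auto
  \<comment> \<open>A column meets more than two rows when the rows in between are single cells, so
    comparing neighbours by \<open>down\<close> is not enough and the upper row is lowered by
    induction.\<close>
  have col: "?T r c < ?T r' c" if "(r, c) \<in> ribbon \<gamma>" "(r', c) \<in> ribbon \<gamma>" "r < r'" for r r' c
    using that(3,1,2)
  proof (induction rule: strict_inc_induct)
    case (base r)
    then obtain k where k: "r = Suc k" using ribbon_row_pos by blast
    then have "Suc k < length \<gamma>" "c = leftcol \<gamma> (Suc k)"
      using base leftcol_overlap[OF pos, of k] by (auto simp: ribbon_Suc_iff)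
    then show ?case using down k base.hyps by simp
  next
    case (step r)
    then obtain k where k: "r = Suc k" using ribbon_row_pos by blast
    obtain p where p: "r' = Suc (Suc p)" "k \<le> p" "k < p"
      using step.hyps k by (metis Suc_less_eq Suc_lessE less_imp_le_nat)
    have lens: "Suc p < length \<gamma>" using step.prems(2) p by (auto simp: ribbon_def)
    \<comment> \<open>Left columns weakly decrease from row to row and squeeze \<open>c\<close>, so
      the row just below \<open>r\<close> has a cell in this column as well.\<close>
    have "c \<le> leftcol \<gamma> (Suc p)"
      using step.prems(2) p leftcol_overlap[OF pos lens] by (auto simp: ribbon_Suc_iff)
    moreover have "leftcol \<gamma> (Suc p) \<le> leftcol \<gamma> (Suc (Suc k))" "leftcol \<gamma> (Suc (Suc k)) \<le> leftcol \<gamma> (Suc k)"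
      using p by (auto intro!: antimono)
    moreover have "leftcol \<gamma> (Suc k) \<le> c"
      using step.prems(1) k by (simp add: ribbon_Suc_iff)
    ultimately have c: "c = leftcol \<gamma> (Suc k)" "c = leftcol \<gamma> (Suc (Suc k))" by auto
    have "1 \<le> \<gamma> ! Suc k" "Suc k < length \<gamma>" using pos lens p by auto
    then have mid: "(Suc r, c) \<in> ribbon \<gamma>"
      using c k by (simp add: ribbon_Suc_iff)
    have "?T r c < ?T (Suc r) c"
      using down[of k] c k \<open>Suc k < length \<gamma>\<close> by simp
    also have "\<dots> < ?T r' c"
      by (rule step.IH[OF mid step.prems(2)])
    finally show ?case .
  qed
  show "?T \<in> ssyt (ribbon \<gamma>)"
    unfolding ssyt_def mem_Collect_eq
  proof (intro conjI allI impI)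
    fix r c show "(r, c) \<in> ribbon \<gamma> \<longleftrightarrow> 1 \<le> ?T r c"
    proof
      assume rc: "(r, c) \<in> ribbon \<gamma>"
      then obtain k where k: "r = Suc k" using ribbon_row_pos by blast
      then have *: "k < length \<gamma>" "leftcol \<gamma> (Suc k) \<le> c" "c - leftcol \<gamma> (Suc k) < \<gamma> ! k"
        using rc by (auto simp: ribbon_Suc_iff)
      then have "rs ! k ! (c - leftcol \<gamma> (Suc k)) \<noteq> 0"
        using sorted(2)[of k] rowlen[of k] by (metis nth_mem)
      then show "1 \<le> ?T r c"
        using rc k by (simp add: filling_of_rows_def)
    qed (auto simp: filling_of_rows_def split: if_splits)
  next
    fix r c c' assume *: "(r, c) \<in> ribbon \<gamma> \<and> (r, c') \<in> ribbon \<gamma> \<and> c < c'"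
    then obtain k where k: "r = Suc k" using ribbon_row_pos by blast
    have "rs ! k ! (c - leftcol \<gamma> (Suc k)) \<le> rs ! k ! (c' - leftcol \<gamma> (Suc k))"
      by (rule sorted_nth_mono) (use * k sorted rowlen in \<open>auto simp: ribbon_Suc_iff\<close>)
    then show "?T r c \<le> ?T r c'"
      using * k by (simp add: filling_of_rows_def)
  next
    fix r r' c assume "(r, c) \<in> ribbon \<gamma> \<and> (r', c) \<in> ribbon \<gamma> \<and> r < r'"
    then show "?T r c < ?T r' c" using col by blast
  qed
qed

lemma filling_of_row_list:
  assumes "T \<in> ssyt (ribbon \<gamma>)"
  shows "filling_of_rows \<gamma> (row_list \<gamma> T) = T"
proof (intro ext)
  fix r c
  show "filling_of_rows \<gamma> (row_list \<gamma> T) r c = T r c"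
  proof (cases "(r, c) \<in> ribbon \<gamma>")
    case True
    then obtain k where k: "r = Suc k" using ribbon_row_pos by blast
    then show ?thesis
      using True nth_row_list_nth[of k \<gamma> "c - leftcol \<gamma> (Suc k)" T]
      by (auto simp: filling_of_rows_def ribbon_Suc_iff)
  next
    case False
    then show ?thesis using assms by (auto simp: filling_of_rows_def ssyt_def)
  qed
qed

lemma bij_betw_row_list:
  assumes "\<forall>a\<in>set \<gamma>. 1 \<le> a"
  shows "bij_betw (row_list \<gamma>) (ssyt (ribbon \<gamma>)) (ribbon_rows \<gamma>)"
  by (rule bij_betw_byWitness[where f' = "filling_of_rows \<gamma>"])
    (use assms filling_of_row_list filling_of_rows_ssyt row_list_in_ribbon_rows in auto)

section \<open>Counting letters row by row\<close>

lemma count_list_map_upt: "count_list (map f [a..<b]) m = card {c. a \<le> c \<and> c < b \<and> f c = m}"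
proof (induction b)
  case (Suc b)
  show ?case
  proof (cases "a \<le> b \<and> f b = m")
    case True
    then have "{c. a \<le> c \<and> c < Suc b \<and> f c = m} = insert b {c. a \<le> c \<and> c < b \<and> f c = m}"
      by (auto simp: less_Suc_eq)
    then show ?thesis using True Suc by simp
  next
    case False
    then have "{c. a \<le> c \<and> c < Suc b \<and> f c = m} = {c. a \<le> c \<and> c < b \<and> f c = m}"
      by (auto simp: less_Suc_eq)
    then show ?thesis using False Suc by auto
  qed
qed simp

lemma finite_ribbon: "finite (ribbon \<gamma>)"
proof -
  have "ribbon \<gamma> \<subseteq> (SIGMA r:{..length \<gamma>}. {..<leftcol \<gamma> r + part \<gamma> r})"
    by (auto simp: ribbon_def)
  then show ?thesis by (rule finite_subset) auto
qed

lemma count_rows_row_count: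
  assumes "T \<in> ssyt (ribbon \<gamma>)" "1 \<le> m" "k \<le> length \<gamma>"
  shows "count_rows T k m = row_count (row_list \<gamma> T) k m"
  using assms(3)
proof (induction k)
  case 0
  have "T 0 c \<noteq> m" for c
    using assms(1,2) by (auto simp: ssyt_def ribbon_def)
  then have empty: "{(r, c). r \<le> 0 \<and> T r c = m} = {}" by auto
  show ?case unfolding count_rows_def empty by (simp add: row_count_def)
next
  case (Suc k)
  let ?row = "{c. leftcol \<gamma> (Suc k) \<le> c \<and> c < leftcol \<gamma> (Suc k) + \<gamma> ! k \<and> T (Suc k) c = m}"
  have in_ribbon: "(r, c) \<in> ribbon \<gamma>" if "T r c = m" for r c
    using assms(1,2) that by (auto simp: ssyt_def)
  have "{(r, c). r \<le> Suc k \<and> T r c = m} = {(r, c). r \<le> k \<and> T r c = m} \<union> {Suc k} \<times> ?row"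
    using in_ribbon[of "Suc k"] Suc.prems by (auto simp: le_Suc_eq ribbon_Suc_iff)
  moreover have "finite {(r, c). r \<le> k \<and> T r c = m}"
    by (rule finite_subset[OF _ finite_ribbon[of \<gamma>]]) (use in_ribbon in auto)
  ultimately have "count_rows T (Suc k) m = count_rows T k m + card ?row"
    unfolding count_rows_def by (simp add: card_Un_disjoint card_cartesian_product disjoint_iff)
  then show ?case
    using Suc by (simp add: row_count_def nth_row_list count_list_map_upt)
qed

lemma cont_row_count:
  assumes "T \<in> ssyt (ribbon \<gamma>)" "1 \<le> m"
  shows "cont T m = row_count (row_list \<gamma> T) (length \<gamma>) m"
proof -
  have "{(r, c). r \<le> length \<gamma> \<and> T r c = m} = {(r, c). T r c = m}"
    using assms by (auto simp: ssyt_def ribbon_def)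
  then have "cont T m = count_rows T (length \<gamma>) m"
    using assms(2) by (simp add: cont_def count_rows_def)
  then show ?thesis using count_rows_row_count[OF assms] by simp
qed

lemma count_concat_take:
  "k \<le> length rs \<Longrightarrow> count_list (concat (take k rs)) m = row_count rs k m"
  by (induction k) (auto simp: row_count_def take_Suc_conv_app_nth)

lemma count_word_of_rows: "count_list (word_of_rows rs) m = row_count rs (length rs) m"
proof -
  have "count_list (word_of_rows rs) m = count_list (concat rs) m"
    by (induction rs) (auto simp: word_of_rows_def)
  then show ?thesis using count_concat_take[of "length rs" rs m] by simp
qed

lemma row_count_0:
  assumes "rs \<in> ribbon_rows \<gamma>" "k \<le> length \<gamma>"
  shows "row_count rs k 0 = 0"
  using assms by (auto simp: row_count_def ribbon_rows_def count_list_0_iff)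

lemma cont_rows:
  assumes "\<forall>a\<in>set \<gamma>. 1 \<le> a" "T \<in> ssyt (ribbon \<gamma>)"
  shows "cont T = row_count (row_list \<gamma> T) (length \<gamma>)"
proof
  fix m show "cont T m = row_count (row_list \<gamma> T) (length \<gamma>) m"
    using cont_row_count[OF assms(2), of m] row_count_0[OF row_list_in_ribbon_rows[OF assms]]
    by (cases "m = 0") (auto simp: cont_def)
qed

text \<open>Each row is read as a weakly decreasing word, so \<open>lattice_from_decreasing\<close>
  replaces all its prefixes by one inequality for each \<open>m\<close>. A general \<mu> is carried
  along because the induction adds the content of the first row to it.\<close>

lemma lattice_from_rows:
  assumes "lattice_from \<mu> []" "\<forall>k<length rs. sorted (rs ! k)"
  shows "lattice_from \<mu> (word_of_rows rs) \<longleftrightarrow> (\<forall>k<length rs. \<forall>m\<ge>1.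
    \<mu> (m + 1) + row_count rs (Suc k) (m + 1) \<le> \<mu> m + row_count rs k m)"
  using assms
proof (induction rs arbitrary: \<mu>)
  case Nil
  then show ?case by (simp add: word_of_rows_def)
next
  case (Cons r rs)
  have "sorted r" "\<forall>k<length rs. sorted (rs ! k)"
    using Cons.prems(2) by (auto simp: All_less_Suc2)
  then have first: "lattice_from \<mu> (rev r) \<longleftrightarrow> (\<forall>m\<ge>1. \<mu> (m + 1) + count_list r (m + 1) \<le> \<mu> m)"
    using lattice_from_decreasing[of "rev r" \<mu>] Cons.prems(1) by (simp add: sorted_wrt_rev)
  have shift: "row_count (r # rs) (Suc k) m = count_list r m + row_count rs k m" for k m
    unfolding row_count_def by (subst sum.lessThan_Suc_shift) simp
  have rev: "count_list (rev r) = count_list r"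
    by (simp add: fun_eq_iff count_list_rev)
  have "lattice_from (\<mu> + count_list r) []" if "lattice_from \<mu> (rev r)"
    using that lattice_from_append[of \<mu> "rev r" "[]"] by (simp add: rev)
  note IH = Cons.IH[OF this \<open>\<forall>k<length rs. sorted (rs ! k)\<close>]
  have "word_of_rows (r # rs) = rev r @ word_of_rows rs"
    by (simp add: word_of_rows_def)
  then have "lattice_from \<mu> (word_of_rows (r # rs)) \<longleftrightarrow> lattice_from \<mu> (rev r) \<and>
     (\<forall>k<length rs. \<forall>m\<ge>1. (\<mu> + count_list r) (m + 1) + row_count rs (Suc k) (m + 1)
        \<le> (\<mu> + count_list r) m + row_count rs k m)"
    using IH by (simp only: lattice_from_append rev cong: conj_cong)
  also have "\<dots> \<longleftrightarrow> (\<forall>k<length (r # rs). \<forall>m\<ge>1.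
      \<mu> (m + 1) + row_count (r # rs) (Suc k) (m + 1) \<le> \<mu> m + row_count (r # rs) k m)"
    unfolding first length_Cons All_less_Suc2 shift
    by (simp add: add.assoc row_count_def[of _ 0])
  finally show ?case .
qed

text \<open>The lattice condition in its form for rows. At \<open>k = 0\<close> the right side is 0,
  so the first row consists of ones.\<close>

definition lr_rows :: "nat list \<Rightarrow> nat list list set" where
  "lr_rows \<gamma> = {rs \<in> ribbon_rows \<gamma>. \<forall>k<length \<gamma>. \<forall>m\<ge>1. row_count rs (Suc k) (m + 1) \<le> row_count rs k m}"

lemma lattice_word_rows:
  assumes "rs \<in> ribbon_rows \<gamma>"
  shows "lattice_word (word_of_rows rs) \<longleftrightarrow> rs \<in> lr_rows \<gamma>"
proof -
  have "lattice_from 0 []" by (simp add: lattice_from_def)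
  moreover have "length rs = length \<gamma>" using assms by (auto simp: ribbon_rows_def)
  ultimately show ?thesis
    using lattice_from_rows[of 0 rs] assms
    by (auto simp: lattice_word_from_0 lr_rows_def ribbon_rows_def)
qed

lemma bij_betw_lr_rows:
  assumes "\<forall>a\<in>set \<gamma>. 1 \<le> a"
  shows "bij_betw (row_list \<gamma>) (lr_tableaux \<gamma>) (lr_rows \<gamma>)"
proof -
  note bij = bij_betw_row_list[OF assms]
  have "row_list \<gamma> ` lr_tableaux \<gamma> = {rs \<in> ribbon_rows \<gamma>. lattice_word (word_of_rows rs)}"
    unfolding bij_betw_imp_surj_on[OF bij, symmetric] lr_tableaux_def reading_word_rows by auto
  also have "\<dots> = lr_rows \<gamma>"
    using lattice_word_rows by (auto simp: lr_rows_def)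
  finally show ?thesis
    using inj_on_subset[OF bij_betw_imp_inj_on[OF bij], of "lr_tableaux \<gamma>"]
    by (auto simp: bij_betw_def lr_tableaux_def)
qed

section \<open>Ribbon tableaux and their reading words\<close>

lemma ribbon_rows_Cons:
  assumes "1 \<le> b"
  shows "ribbon_rows (a # b # \<gamma>) =
    {r # rs | r rs. length r = a \<and> sorted r \<and> 0 \<notin> set r \<and> rs \<in> ribbon_rows (b # \<gamma>) \<and> hd r < last (hd rs)}"
  (is "?l = ?r")
proof (intro equalityI subsetI)
  fix x assume x: "x \<in> ?l"
  then obtain r s rs where eq: "x = r # s # rs"
    by (auto simp: ribbon_rows_def map_eq_Cons_conv)
  show "x \<in> ?r"
    using x unfolding eq by (auto simp: ribbon_rows_def All_less_Suc2 dest: spec[of _ 0] spec[of _ "Suc _"])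
next
  fix x assume "x \<in> ?r"
  then obtain r s rs where "x = r # s # rs" "length r = a" "sorted r" "0 \<notin> set r"
    "s # rs \<in> ribbon_rows (b # \<gamma>)" "hd r < last s"
    by (auto simp: ribbon_rows_def map_eq_Cons_conv)
  then show "x \<in> ?l"
    by (auto simp: ribbon_rows_def All_less_Suc2 nth_Cons split: nat.splits)
qed

text \<open>Reversing a row exchanges its first and last entries, which turns the column condition
  of \<open>ribbon_rows\<close> into that of \<open>ribbon_words\<close>.\<close>

lemma word_of_rows_image:
  assumes "\<forall>a\<in>set \<gamma>. 1 \<le> a"
  shows "word_of_rows ` ribbon_rows \<gamma> = ribbon_words \<gamma>"
  using assms
proof (induction \<gamma> rule: ribbon_words.induct)
  case 1
  then show ?case by (auto simp: ribbon_rows_def word_of_rows_def)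
next
  case (2 a)
  have decr: "w \<in> decreasing_words a \<longleftrightarrow> length (rev w) = a \<and> sorted (rev w) \<and> 0 \<notin> set (rev w)" for w
    by (auto simp: decreasing_words_def words_def sorted_wrt_rev)
  have "ribbon_rows [a] = {[r] | r. length r = a \<and> sorted r \<and> 0 \<notin> set r}"
    by (auto simp: ribbon_rows_def map_eq_Cons_conv)
  moreover have "word_of_rows [r] = rev r" for r
    by (simp add: word_of_rows_def)
  ultimately have "word_of_rows ` ribbon_rows [a] = rev ` {r. length r = a \<and> sorted r \<and> 0 \<notin> set r}"
    by (simp add: setcompr_eq_image image_image)
  also have "\<dots> = decreasing_words a"
  proof (intro equalityI subsetI)
    fix w assume "w \<in> decreasing_words a"
    then show "w \<in> rev ` {r. length r = a \<and> sorted r \<and> 0 \<notin> set r}"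
      using decr by (intro image_eqI[of _ _ "rev w"]) auto
  qed (auto simp: decreasing_words_def words_def sorted_wrt_rev)
  finally show ?case by simp
next
  case (3 a b \<gamma>)
  have IH: "word_of_rows ` ribbon_rows (b # \<gamma>) = ribbon_words (b # \<gamma>)"
    using 3 by simp
  have decr: "w \<in> decreasing_words a \<longleftrightarrow> length (rev w) = a \<and> sorted (rev w) \<and> 0 \<notin> set (rev w)" for w
    by (auto simp: decreasing_words_def words_def sorted_wrt_rev)
  have hd_word: "hd (word_of_rows rs) = last (hd rs)" if "rs \<in> ribbon_rows (b # \<gamma>)" for rs
    using that 3(2) by (auto simp: ribbon_rows_def map_eq_Cons_conv word_of_rows_def hd_append hd_rev)
  have last_rev: "last (rev r) = hd r" if "length r = a" for r :: "nat list"
    using that 3(2) by (simp add: last_rev)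
  show ?case
  proof (intro equalityI subsetI)
    fix w assume "w \<in> word_of_rows ` ribbon_rows (a # b # \<gamma>)"
    then obtain r rs where w: "w = rev r @ word_of_rows rs" and r: "length r = a" "sorted r" "0 \<notin> set r"
      and rs: "rs \<in> ribbon_rows (b # \<gamma>)" "hd r < last (hd rs)"
      using 3(2) by (auto simp: ribbon_rows_Cons word_of_rows_def)
    have "rev r \<in> decreasing_words a" using r by (simp add: decr)
    moreover have "word_of_rows rs \<in> ribbon_words (b # \<gamma>)"
      using IH rs(1) by blast
    ultimately show "w \<in> ribbon_words (a # b # \<gamma>)"
      unfolding ribbon_words.simps using w rs hd_word[OF rs(1)] last_rev[OF r(1)]
      by (intro CollectI exI[of _ "rev r"] exI[of _ "word_of_rows rs"]) simp
  next
    fix w assume "w \<in> ribbon_words (a # b # \<gamma>)"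
    then obtain u v where w: "w = u @ v" "u \<in> decreasing_words a" "v \<in> ribbon_words (b # \<gamma>)" "last u < hd v"
      by auto
    then obtain rs where rs: "rs \<in> ribbon_rows (b # \<gamma>)" "v = word_of_rows rs"
      using IH by auto
    have u: "length (rev u) = a" "sorted (rev u)" "0 \<notin> set (rev u)"
      using w(2) decr by auto
    have "rev u # rs \<in> ribbon_rows (a # b # \<gamma>)"
      using 3(2) u rs w(4) hd_word[OF rs(1)] last_rev[OF u(1)] by (simp add: ribbon_rows_Cons)
    moreover have "w = word_of_rows (rev u # rs)"
      using w rs by (simp add: word_of_rows_def)
    ultimately show "w \<in> word_of_rows ` ribbon_rows (a # b # \<gamma>)" by blast
  qed
qed

text \<open>The row lengths are prescribed by \<gamma>, so they determine where to cut the
  word.\<close>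

lemma inj_on_word_of_rows: "inj_on word_of_rows (ribbon_rows \<gamma>)"
proof (rule inj_onI)
  fix rs rs' assume *: "rs \<in> ribbon_rows \<gamma>" "rs' \<in> ribbon_rows \<gamma>" "word_of_rows rs = word_of_rows rs'"
  then have len: "map length rs = map length rs'" by (simp add: ribbon_rows_def)
  then have len': "length rs = length rs'" by (metis length_map)
  have "map rev rs = map rev rs'"
  proof (rule concat_injective)
    show "\<forall>(x, y)\<in>set (zip (map rev rs) (map rev rs')). length x = length y"
      using len len' by (auto simp: set_zip) (metis nth_map)
  qed (use * len' in \<open>auto simp: word_of_rows_def\<close>)
  then show "rs = rs'" by (metis inj_map_eq_map inj_on_rev)
qed

lemma bij_betw_reading_word:
  assumes "\<forall>a\<in>set \<gamma>. 1 \<le> a"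
  shows "bij_betw (reading_word \<gamma>) (ssyt (ribbon \<gamma>)) (ribbon_words \<gamma>)"
proof -
  have "bij_betw word_of_rows (ribbon_rows \<gamma>) (ribbon_words \<gamma>)"
    using inj_on_word_of_rows word_of_rows_image[OF assms] by (simp add: bij_betw_def)
  from bij_betw_trans[OF bij_betw_row_list[OF assms] this] show ?thesis
    by (simp add: o_def reading_word_rows[abs_def])
qed

lemma count_reading_word:
  assumes "\<forall>a\<in>set \<gamma>. 1 \<le> a" "T \<in> ssyt (ribbon \<gamma>)"
  shows "count_list (reading_word \<gamma> T) = cont T"
  by (simp add: reading_word_rows fun_eq_iff count_word_of_rows cont_rows[OF assms])

lemma finite_lr_tableaux:
  assumes "\<forall>a\<in>set \<gamma>. 1 \<le> a"
  shows "finite (lr_tableaux \<gamma>)"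
proof -
  have "reading_word \<gamma> ` lr_tableaux \<gamma> \<subseteq> {w \<in> words (sum_list \<gamma>). lattice_from 0 w}"
    using bij_betw_imp_surj_on[OF bij_betw_reading_word[OF assms]] ribbon_words_subset[of \<gamma>]
    by (auto simp: lr_tableaux_def lattice_word_from_0)
  moreover have "finite {w \<in> words (sum_list \<gamma>). lattice_from 0 w}"
    by (rule finite_lattice_words) (simp add: is_partition_def)
  ultimately have "finite (reading_word \<gamma> ` lr_tableaux \<gamma>)"
    by (rule finite_subset)
  then show ?thesis
    by (rule finite_imageD)
      (use bij_betw_imp_inj_on[OF bij_betw_reading_word[OF assms]] in \<open>auto simp: lr_tableaux_def intro: inj_on_subset\<close>)
qed

lemma sum_fun_apply: "(\<Sum>x\<in>A. f x) e = (\<Sum>x\<in>A. f x e :: int)"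
  by (induction A rule: infinite_finite_induct) auto

text \<open>At each coefficient this is \<open>card_ribbon_words\<close>, carried from words to
  tableaux by the reading word, which is bijective and preserves the content.\<close>

theorem ribbon_littlewood_richardson:
  assumes "\<forall>a\<in>set \<gamma>. 1 \<le> a" "\<gamma> \<noteq> []"
  shows "ribbon_schur \<gamma> = (\<Sum>T\<in>lr_tableaux \<gamma>. schur (cont T))"
proof
  fix e
  note bij = bij_betw_reading_word[OF assms(1)]
  have "bij_betw (reading_word \<gamma>) {T \<in> ssyt (ribbon \<gamma>). cont T = e} {w \<in> ribbon_words \<gamma>. count_list w = e}"
    using bij_betw_imp_surj_on[OF bij] inj_on_subset[OF bij_betw_imp_inj_on[OF bij]] count_reading_word[OF assms(1)]
    by (auto simp: bij_betw_def image_iff set_eq_iff) metis+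
  then have "ribbon_schur \<gamma> e = int (card {w \<in> ribbon_words \<gamma>. count_list w = e})"
    by (simp add: ribbon_schur_def tableau_series_def bij_betw_same_card)
  also have "\<dots> = (\<Sum>w | w \<in> ribbon_words \<gamma> \<and> lattice_word w. schur (count_list w) e)"
    unfolding card_ribbon_words[OF assms] by (simp add: schur_def tableau_series_def kostka_def)
  also have "\<dots> = (\<Sum>T\<in>lr_tableaux \<gamma>. schur (cont T) e)"
  proof (rule sum.reindex_cong[of "reading_word \<gamma>"])
    show "inj_on (reading_word \<gamma>) (lr_tableaux \<gamma>)"
      by (rule inj_on_subset[OF bij_betw_imp_inj_on[OF bij]]) (auto simp: lr_tableaux_def)
    show "{w. w \<in> ribbon_words \<gamma> \<and> lattice_word w} = reading_word \<gamma> ` lr_tableaux \<gamma>"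
      unfolding bij_betw_imp_surj_on[OF bij, symmetric] lr_tableaux_def by auto
  qed (simp add: count_reading_word[OF assms(1)] lr_tableaux_def)
  finally show "ribbon_schur \<gamma> e = (\<Sum>T\<in>lr_tableaux \<gamma>. schur (cont T)) e"
    by (simp add: sum_fun_apply)
qed

subsection \<open>Moving ones between rows\<close>

lemma ribbon_rowsD:
  assumes "rs \<in> ribbon_rows \<gamma>"
  shows "length rs = length \<gamma>"
    and "k < length \<gamma> \<Longrightarrow> length (rs ! k) = \<gamma> ! k"
    and "k < length \<gamma> \<Longrightarrow> sorted (rs ! k)"
    and "k < length \<gamma> \<Longrightarrow> x \<in> set (rs ! k) \<Longrightarrow> 1 \<le> x"
    and "Suc k < length \<gamma> \<Longrightarrow> hd (rs ! k) < last (rs ! Suc k)"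
proof -
  show len: "length rs = length \<gamma>"
    using assms by (auto simp: ribbon_rows_def)
  have \<gamma>: "\<gamma> = map length rs"
    using assms by (simp add: ribbon_rows_def)
  show "length (rs ! k) = \<gamma> ! k" if "k < length \<gamma>"
    using that unfolding \<gamma> by simp
  show "sorted (rs ! k)" if "k < length \<gamma>"
    using assms that len by (simp add: ribbon_rows_def)
  show "hd (rs ! k) < last (rs ! Suc k)" if "Suc k < length \<gamma>"
    using assms that len by (simp add: ribbon_rows_def)
  show "1 \<le> x" if "k < length \<gamma>" "x \<in> set (rs ! k)"
  proof -
    have "0 \<notin> set (rs ! k)"
      using assms that(1) len by (simp add: ribbon_rows_def)
    then show ?thesis
      using that(2) by (cases x) auto
  qed
qed

lemma row_count_Suc: "row_count rs (Suc k) m = row_count rs k m + count_list (rs ! k) m"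
  by (simp add: row_count_def)

lemma count_list_replicate: "count_list (replicate n x) y = (if x = y then n else 0)"
  by (induction n) auto

text \<open>By induction the rows above are single cells with entries 1, ..., \<open>p\<close>. The
  lattice condition then admits, besides ones, only the letter \<open>p + 1\<close>, and at most
  once; for \<open>p > 0\<close> the column condition forces it at the right end. For
  \<open>p = 0\<close> the last entry \<open>p + 1\<close> is itself a one.\<close>

lemma lr_rows_initial:
  assumes pos: "\<forall>a\<in>set \<gamma>. 1 \<le> a" and rs: "rs \<in> lr_rows \<gamma>"
    and p: "p < length \<gamma>" "\<forall>k<p. \<gamma> ! k = 1"
  shows "rs ! p = replicate (\<gamma> ! p - 1) 1 @ [p + 1]"
  using p
proof (induction p rule: less_induct)
  case (less p)
  have rs': "rs \<in> ribbon_rows \<gamma>"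
    using rs by (simp add: lr_rows_def)
  have lr: "row_count rs (Suc p) (m + 1) \<le> row_count rs p m" if "1 \<le> m" for m
    using rs less.prems(1) that by (simp add: lr_rows_def)
  have prev: "rs ! k = [k + 1]" if "k < p" for k
    using less.IH[of k] less.prems that by simp
  have count: "row_count rs p m = (if 1 \<le> m \<and> m \<le> p then 1 else 0)" for m
  proof -
    have "row_count rs q m = (if 1 \<le> m \<and> m \<le> q then 1 else 0)" if "q \<le> p" for q
      using that by (induction q) (auto simp: row_count_def prev)
    then show ?thesis by simp
  qed
  have len: "length (rs ! p) = \<gamma> ! p" "\<gamma> ! p \<ge> 1"
    using ribbon_rowsD(2)[OF rs'] pos less.prems(1) by auto
  define s where "s = butlast (rs ! p)"
  define l where "l = last (rs ! p)"
  have row: "rs ! p = s @ [l]"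
    using len by (auto simp: s_def l_def intro!: append_butlast_last_id[symmetric])
  have entry: "x = p + 1 \<and> count_list (rs ! p) x = 1" if "x \<in> set (rs ! p)" "x \<noteq> 1" for x
  proof -
    have "1 \<le> x" using ribbon_rowsD(4)[OF rs' less.prems(1) that(1)] .
    then have x: "2 \<le> x" using that(2) by simp
    have "row_count rs p x + count_list (rs ! p) x \<le> row_count rs p (x - 1)"
      using lr[of "x - 1"] x by (simp add: row_count_Suc)
    moreover have "count_list (rs ! p) x \<noteq> 0"
      using that(1) by (simp add: count_list_0_iff)
    ultimately show ?thesis
      using x by (auto simp: count split: if_splits)
  qed
  have last: "l = p + 1"
  proof (cases p)
    case 0
    show ?thesis
      using entry[of l] row 0 by (cases "l = 1") auto
  next
    case (Suc q)
    \<comment> \<open>The entry above the right end is \<open>p\<close>, which is at least 1, so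
      \<open>l\<close> is not a one.\<close>
    have "hd (rs ! q) < l"
      using ribbon_rowsD(5)[OF rs', of q] less.prems(1) Suc by (simp add: l_def)
    then show ?thesis
      using entry[of l] row prev[of q] Suc by auto
  qed
  have "x = 1" if "x \<in> set s" for x
  proof (rule ccontr)
    assume "x \<noteq> 1"
    then have "x = p + 1" "count_list (rs ! p) x = 1"
      using entry[of x] that row by auto
    moreover have "count_list s x \<noteq> 0" using that by (simp add: count_list_0_iff)
    ultimately show False using row last by simp
  qed
  then have "s = replicate (length s) 1"
    by (simp add: replicate_eqI)
  moreover have "length s = \<gamma> ! p - 1"
    using len by (simp add: s_def)
  ultimately show ?case
    using row last by simp
qed

text \<open>Below rows are indexed from 0: \<open>a = i - 1\<close> and \<open>b = j - 1\<close>.\<close>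

definition move_composition :: "nat \<Rightarrow> nat \<Rightarrow> nat \<Rightarrow> nat list \<Rightarrow> nat list" where
  "move_composition a b t \<gamma> = \<gamma>[a := \<gamma> ! a - t, b := \<gamma> ! b + t]"

text \<open>Exchanging the two row arguments gives the inverse move, so one definition serves both
  directions.\<close>

definition move_ones :: "nat \<Rightarrow> nat \<Rightarrow> nat \<Rightarrow> nat list list \<Rightarrow> nat list list" where
  "move_ones a b t rs = rs[a := drop t (rs ! a), b := replicate t 1 @ rs ! b]"

text \<open>This describes the complement of \<open>A_set\<close>: the first \<open>k\<close> rows
  can spare \<open>t\<close> ones without violating the lattice condition.\<close>

definition movable_rows :: "nat \<Rightarrow> nat \<Rightarrow> nat \<Rightarrow> nat list \<Rightarrow> nat list list set" where
  "movable_rows a b t \<gamma> = {rs \<in> lr_rows \<gamma>. \<forall>k. a < k \<and> k \<le> b \<longrightarrow> t + row_count rs (Suc k) 2 \<le> row_count rs k 1}"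

text \<open>This describes the complement of \<open>B_set\<close>: when the \<open>t\<close> ones
  are taken away, \<open>rs ! b ! t\<close> becomes the left end of its row and has to be smaller
  than the entry below it.\<close>

definition moved_rows :: "nat \<Rightarrow> nat \<Rightarrow> nat list \<Rightarrow> nat list list set" where
  "moved_rows b t \<gamma> = {rs \<in> lr_rows \<gamma>. take t (rs ! b) = replicate t 1 \<and>
     (Suc b < length \<gamma> \<longrightarrow> rs ! b ! t < last (rs ! Suc b))}"

text \<open>The corrections for the two rows stand on opposite sides, which avoids subtraction.
  Beyond both rows they cancel, so the move preserves the content.\<close>

lemma row_count_move:
  assumes "a \<noteq> b" "a < length rs" "b < length rs" "take t (rs ! a) = replicate t 1"
  shows "row_count (move_ones a b t rs) k m + (if m = 1 \<and> a < k then t else 0) =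
    row_count rs k m + (if m = 1 \<and> b < k then t else 0)"
proof -
  have split: "count_list (rs ! a) m = (if m = 1 then t else 0) + count_list (drop t (rs ! a)) m"
    using arg_cong[OF append_take_drop_id[of t "rs ! a"], of "\<lambda>w. count_list w m"]
    by (auto simp: assms(4) count_list_replicate simp del: append_take_drop_id split: if_splits)
  have step: "count_list (move_ones a b t rs ! k) m + (if m = 1 \<and> k = a then t else 0) =
    count_list (rs ! k) m + (if m = 1 \<and> k = b then t else 0)" for k
    using split assms by (auto simp: move_ones_def nth_list_update count_list_replicate)
  show ?thesis
  proof (induction k)
    case (Suc k)
    then show ?case
      using step[of k] by (auto simp: row_count_Suc less_Suc_eq split: if_splits)
  qed (simp add: row_count_def)
qed

text \<open>Only left ends change. The lattice inequality for \<open>m = 1\<close> loses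
  \<open>t\<close> exactly when \<open>a < k \<le> b\<close>, which movability allows for. The
  delicate point is the new left end of row \<open>a\<close>, where the column condition has to be
  proved anew.\<close>

lemma move_ones_movable:
  assumes pos: "\<forall>x\<in>set \<gamma>. 1 \<le> x" and ab: "a < b" "b < length \<gamma>" and ones: "\<forall>k<a. \<gamma> ! k = 1"
    and t: "1 \<le> t" "t < \<gamma> ! a" and rs: "rs \<in> movable_rows a b t \<gamma>"
  shows "move_ones a b t rs \<in> moved_rows b t (move_composition a b t \<gamma>)"
    and "take t (rs ! a) = replicate t 1"
proof -
  let ?\<delta> = "move_composition a b t \<gamma>" and ?f = "move_ones a b t rs"
  have lr: "rs \<in> lr_rows \<gamma>"
    and movable: "\<And>k. a < k \<Longrightarrow> k \<le> b \<Longrightarrow> t + row_count rs (Suc k) 2 \<le> row_count rs k 1"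
    using rs by (auto simp: movable_rows_def)
  have rr: "rs \<in> ribbon_rows \<gamma>"
    using lr by (simp add: lr_rows_def)
  have lattice: "row_count rs (Suc k) (m + 1) \<le> row_count rs k m" if "k < length \<gamma>" "1 \<le> m" for k m
    using lr that by (simp add: lr_rows_def)
  note D = ribbon_rowsD[OF rr]
  have row_a: "rs ! a = replicate (\<gamma> ! a - 1) 1 @ [a + 1]"
    using lr_rows_initial[OF pos lr _ ones] ab by simp
  have row_k: "rs ! k = [k + 1]" if "k < a" for k
    using lr_rows_initial[OF pos lr, of k] ones that ab by simp
  show take: "take t (rs ! a) = replicate t 1"
    unfolding row_a using t by (simp add: take_replicate)
  have count: "row_count (move_ones a b t rs) k m + (if m = 1 \<and> a < k then t else 0) =
      row_count rs k m + (if m = 1 \<and> b < k then t else 0)" for k m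
    using row_count_move[OF _ _ _ take] ab D(1) by simp
  have len: "length ?f = length \<gamma>" "length ?\<delta> = length \<gamma>"
    by (simp_all add: move_ones_def move_composition_def D(1))
  have nth: "?f ! k = (if k = b then replicate t 1 @ rs ! b else if k = a then drop t (rs ! a) else rs ! k)"
    if "k < length \<gamma>" for k
    using that ab D(1) by (auto simp: move_ones_def nth_list_update)
  have ne: "rs ! k \<noteq> []" if "k < length \<gamma>" for k
    using D(2)[OF that] pos that by (metis list.size(3) nth_mem not_one_le_zero)
  \<comment> \<open>Row \<open>a\<close> keeps its right end since \<open>t < \<gamma> ! a\<close>,
    and row \<open>b\<close> is extended only on the left.\<close>
  have last: "last (?f ! k) = last (rs ! k)" if "k < length \<gamma>" for k
    using that ne[OF that] t D(2)[of a] ab by (auto simp: nth last_drop)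
  have count_a: "row_count rs (Suc a) m = (if m = 1 then \<gamma> ! a - 1 else 0) + (if 1 \<le> m \<and> m \<le> a + 1 then 1 else 0)" for m
  proof -
    have "row_count rs q m = (if 1 \<le> m \<and> m \<le> q then 1 else 0)" if "q \<le> a" for q
      using that by (induction q) (auto simp: row_count_def row_k)
    then show ?thesis
      by (auto simp: row_count_Suc row_a count_list_replicate)
  qed
  have hd_a: "hd (drop t (rs ! a)) < last (rs ! Suc a)"
  proof (cases "t < \<gamma> ! a - 1")
    case True
    then have "hd (drop t (rs ! a)) = hd (rs ! a)"
      unfolding row_a using t by (cases "\<gamma> ! a - 1 - t") (auto simp: hd_append)
    then show ?thesis using D(5)[of a] ab by simp
  next
    \<comment> \<open>All ones leave row \<open>a\<close>, and \<open>a + 1\<close> becomes its left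
      end. If the entry \<open>x\<close> below were at most \<open>a + 1\<close>, it would already
      occur in the rows above. Then \<open>x = 2\<close> contradicts movability, and
      \<open>x > 2\<close> contradicts the lattice condition, because \<open>x - 1\<close> occurs
      only once there.\<close>
    case False
    then have t_eq: "t = \<gamma> ! a - 1" using t by simp
    then have hd: "hd (drop t (rs ! a)) = a + 1"
      unfolding row_a by simp
    define x where "x = last (rs ! Suc a)"
    have x_in: "x \<in> set (rs ! Suc a)"
      using ne[of "Suc a"] ab by (simp add: x_def)
    have "1 \<le> hd (rs ! a)"
      using D(4)[of a "hd (rs ! a)"] ne[of a] ab by simp
    then have x: "2 \<le> x"
      using D(5)[of a] ab by (simp add: x_def)
    have counts: "count_list (rs ! Suc a) x \<noteq> 0"
      using x_in by (simp add: count_list_0_iff)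
    have "a + 1 < x"
    proof (rule ccontr)
      assume "\<not> a + 1 < x"
      then have "x \<le> a + 1" by simp
      show False
      proof (cases "x = 2")
        case True
        then show False
          using movable[of "Suc a"] ab counts t_eq \<open>x \<le> a + 1\<close>
          by (auto simp: row_count_Suc[of _ "Suc a"] count_a)
      next
        case False
        then have "1 \<le> x - 1" "x - 1 \<noteq> 1" using x by auto
        then show False
          using lattice[of "Suc a" "x - 1"] x ab counts \<open>x \<le> a + 1\<close>
          by (auto simp: row_count_Suc[of _ "Suc a"] count_a split: if_splits)
      qed
    qed
    then show ?thesis using hd by (simp add: x_def)
  qed
  have "?f \<in> ribbon_rows ?\<delta>"
    unfolding ribbon_rows_def mem_Collect_eq
  proof (intro conjI allI impI)
    show "map length ?f = ?\<delta>"
      using D(1,2) ab by (intro nth_equalityI) (auto simp: len nth move_composition_def nth_list_update)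
  next
    fix k assume "k < length ?f"
    then have k: "k < length \<gamma>" by (simp add: len)
    have "sorted (replicate t 1 @ rs ! b)"
      using D(3)[OF ab(2)] D(4)[OF ab(2)] by (auto simp: sorted_append)
    then show "sorted (?f ! k)"
      using D(3) k ab by (auto simp: nth sorted_wrt_drop)
    have "0 \<notin> set (rs ! k)" if "k < length \<gamma>" for k
      using D(4)[OF that, of 0] by auto
    then show "0 \<notin> set (?f ! k)"
      using k ab by (auto simp: nth dest: in_set_dropD)
  next
    fix k assume "Suc k < length ?f"
    then have k: "Suc k < length \<gamma>" by (simp add: len)
    \<comment> \<open>The new left end of row \<open>b\<close> is a one, no larger than the old one,
      so the column condition below it survives.\<close>
    have "1 \<le> hd (rs ! b)"
      using D(4)[OF ab(2), of "hd (rs ! b)"] ne[OF ab(2)] by simp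
    then have "hd (?f ! k) \<le> (if k = a then hd (drop t (rs ! a)) else hd (rs ! k))"
      using k t ab by (auto simp: nth hd_append)
    then show "hd (?f ! k) < last (?f ! Suc k)"
      using hd_a D(5)[OF k] last[OF k] by (auto split: if_splits)
  qed
  moreover have "row_count ?f (Suc k) (m + 1) \<le> row_count ?f k m" if k: "k < length \<gamma>" and m: "1 \<le> m" for k m
  proof -
    have "row_count ?f (Suc k) (m + 1) = row_count rs (Suc k) (m + 1)"
      using count[of "Suc k" "m + 1"] ab D(1) m by simp
    moreover have "row_count rs (Suc k) (m + 1) \<le> row_count ?f k m"
      using count[of k m] ab D(1) lattice[OF k m] movable[of k] by (auto simp: numeral_2_eq_2 split: if_splits)
    ultimately show ?thesis by simp
  qed
  ultimately have "?f \<in> lr_rows ?\<delta>"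
    by (simp add: lr_rows_def len)
  \<comment> \<open>The entry behind the new ones is the old left end of row \<open>b\<close>, so
    the last condition of \<open>moved_rows\<close> is the old column condition.\<close>
  moreover have "?f ! b ! t = hd (rs ! b)"
    using ab nth ne[OF ab(2)] by (simp add: nth_append hd_conv_nth)
  ultimately show "?f \<in> moved_rows b t ?\<delta>"
    using nth[OF ab(2)] D(5)[of b] last[of "Suc b"] by (auto simp: moved_rows_def len)
qed

text \<open>Returning the ones raises the counts of the letter 1 by \<open>t\<close> for
  \<open>a < k \<le> b\<close> and changes no other count. So the lattice condition persists, with
  exactly the slack that \<open>movable_rows\<close> demands. The new left end of row
  \<open>b\<close> is covered by \<open>moved_rows\<close>.\<close>

lemma move_ones_moved:
  assumes pos: "\<forall>x\<in>set \<gamma>. 1 \<le> x" and ab: "a < b" "b < length \<gamma>"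
    and t: "1 \<le> t" "t < \<gamma> ! a" and rs: "rs \<in> moved_rows b t (move_composition a b t \<gamma>)"
  shows "move_ones b a t rs \<in> movable_rows a b t \<gamma>"
    and "take t (rs ! b) = replicate t 1"
proof -
  let ?\<delta> = "move_composition a b t \<gamma>" and ?g = "move_ones b a t rs"
  have lr: "rs \<in> lr_rows ?\<delta>" and take: "take t (rs ! b) = replicate t 1"
    and next_row: "Suc b < length \<gamma> \<Longrightarrow> rs ! b ! t < last (rs ! Suc b)"
    using rs by (auto simp: moved_rows_def move_composition_def)
  show "take t (rs ! b) = replicate t 1" by (rule take)
  have len\<delta>: "length ?\<delta> = length \<gamma>"
    by (simp add: move_composition_def)
  have rr: "rs \<in> ribbon_rows ?\<delta>"
    using lr by (simp add: lr_rows_def)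
  have lattice: "row_count rs (Suc k) (m + 1) \<le> row_count rs k m" if "k < length \<gamma>" "1 \<le> m" for k m
    using lr that by (simp add: lr_rows_def len\<delta>)
  note D = ribbon_rowsD[OF rr, unfolded len\<delta>]
  have \<delta>: "?\<delta> ! k = (if k = b then \<gamma> ! b + t else if k = a then \<gamma> ! a - t else \<gamma> ! k)" if "k < length \<gamma>" for k
    using that ab by (auto simp: move_composition_def nth_list_update)
  have len: "length ?g = length \<gamma>"
    by (simp add: move_ones_def D(1))
  have nth: "?g ! k = (if k = b then drop t (rs ! b) else if k = a then replicate t 1 @ rs ! a else rs ! k)"
    if "k < length \<gamma>" for k
    using that ab D(1) by (auto simp: move_ones_def nth_list_update)
  have pos\<gamma>: "1 \<le> \<gamma> ! k" if "k < length \<gamma>" for k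
    using pos that by simp
  have ne: "rs ! k \<noteq> []" if "k < length \<gamma>" for k
    using D(2)[OF that] \<delta>[OF that] pos\<gamma>[OF that] t by (auto split: if_splits)
  have len_b: "length (rs ! b) = \<gamma> ! b + t"
    using D(2)[OF ab(2)] \<delta>[OF ab(2)] by simp
  have last: "last (?g ! k) = last (rs ! k)" if "k < length \<gamma>" for k
    using that ne[OF that] len_b pos\<gamma>[OF ab(2)] by (auto simp: nth last_drop)
  have count: "row_count ?g k m = row_count rs k m + (if m = 1 \<and> a < k \<and> k \<le> b then t else 0)" for k m
    using row_count_move[OF _ _ _ take, of a k m] ab D(1) by (auto split: if_splits)
  have "?g \<in> ribbon_rows \<gamma>"
    unfolding ribbon_rows_def mem_Collect_eq
  proof (intro conjI allI impI)
    show "map length ?g = \<gamma>"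
      using D(1,2) \<delta> ab t by (intro nth_equalityI) (auto simp: len nth)
  next
    fix k assume "k < length ?g"
    then have k: "k < length \<gamma>" by (simp add: len)
    have "sorted (replicate t 1 @ rs ! a)"
      using D(3)[of a] D(4)[of a] ab by (auto simp: sorted_append)
    then show "sorted (?g ! k)"
      using D(3) k ab by (auto simp: nth sorted_wrt_drop)
    have "0 \<notin> set (rs ! k)" if "k < length \<gamma>" for k
      using D(4)[OF that, of 0] by auto
    then show "0 \<notin> set (?g ! k)"
      using k ab by (auto simp: nth dest: in_set_dropD)
  next
    fix k assume "Suc k < length ?g"
    then have k: "Suc k < length \<gamma>" by (simp add: len)
    have "hd (?g ! k) \<le> (if k = b then rs ! b ! t else hd (rs ! k))"
    proof (cases "k = a")
      case True
      have "1 \<le> hd (rs ! a)"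
        using D(4)[of a "hd (rs ! a)"] ne[of a] ab by simp
      then show ?thesis using k t ab True by (auto simp: nth hd_append)
    next
      case False
      then show ?thesis
        using k len_b pos\<gamma>[OF ab(2)] by (auto simp: nth hd_drop_conv_nth)
    qed
    then show "hd (?g ! k) < last (?g ! Suc k)"
      using next_row D(5)[OF k] last[OF k] k by (auto split: if_splits)
  qed
  moreover have "row_count ?g (Suc k) (m + 1) \<le> row_count ?g k m" if k: "k < length \<gamma>" and m: "1 \<le> m" for k m
    using count lattice[OF k m] m by simp
  ultimately have "?g \<in> lr_rows \<gamma>"
    by (simp add: lr_rows_def)
  moreover have "t + row_count ?g (Suc k) 2 \<le> row_count ?g k 1" if "a < k" "k \<le> b" for k
    using count lattice[of k 1] that ab by (simp add: numeral_2_eq_2)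
  ultimately show "?g \<in> movable_rows a b t \<gamma>"
    by (simp add: movable_rows_def)
qed

lemma move_ones_inverse:
  assumes "a \<noteq> b" "a < length rs" "b < length rs" "take t (rs ! a) = replicate t 1"
  shows "move_ones b a t (move_ones a b t rs) = rs"
proof (rule nth_equalityI)
  have row: "replicate t 1 @ drop t (rs ! a) = rs ! a"
    by (metis append_take_drop_id assms(4))
  fix k assume "k < length (move_ones b a t (move_ones a b t rs))"
  then show "move_ones b a t (move_ones a b t rs) ! k = rs ! k"
    using assms(1-3) row by (auto simp: move_ones_def nth_list_update)
qed (simp add: move_ones_def)

lemma bij_betw_move_ones:
  assumes "\<forall>x\<in>set \<gamma>. 1 \<le> x" "a < b" "b < length \<gamma>" "\<forall>k<a. \<gamma> ! k = 1" "1 \<le> t" "t < \<gamma> ! a"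
  shows "bij_betw (move_ones a b t) (movable_rows a b t \<gamma>) (moved_rows b t (move_composition a b t \<gamma>))"
proof (rule bij_betw_byWitness[where f' = "move_ones b a t"])
  note movable = move_ones_movable[OF assms] and moved = move_ones_moved[OF assms(1,2,3,5,6)]
  show "move_ones a b t ` movable_rows a b t \<gamma> \<subseteq> moved_rows b t (move_composition a b t \<gamma>)"
    using movable(1) by blast
  show "move_ones b a t ` moved_rows b t (move_composition a b t \<gamma>) \<subseteq> movable_rows a b t \<gamma>"
    using moved(1) by blast
  have "length rs = length \<gamma>" if "rs \<in> movable_rows a b t \<gamma>" for rs
    using that by (simp add: movable_rows_def lr_rows_def ribbon_rowsD(1))
  then show "\<forall>rs\<in>movable_rows a b t \<gamma>. move_ones b a t (move_ones a b t rs) = rs"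
    using movable(2) assms(2,3) by (intro ballI move_ones_inverse) auto
  have "length rs = length \<gamma>" if "rs \<in> moved_rows b t (move_composition a b t \<gamma>)" for rs
    using that by (auto simp: moved_rows_def lr_rows_def move_composition_def dest: ribbon_rowsD(1))
  then show "\<forall>rs\<in>moved_rows b t (move_composition a b t \<gamma>). move_ones a b t (move_ones b a t rs) = rs"
    using moved(2) assms(2,3) by (intro ballI move_ones_inverse) auto
qed

section \<open>The sets A and B in terms of rows\<close>

lemma move_cells_composition:
  "1 \<le> i \<Longrightarrow> 1 \<le> j \<Longrightarrow> move_cells i j t \<gamma> = move_composition (i - 1) (j - 1) t \<gamma>"
  by (simp add: move_cells_def move_composition_def part_def)

text \<open>With \<open>i = a + 1\<close> and \<open>j = b + 1\<close> the range of
  \<open>j'\<close> becomes \<open>a < k \<le> b\<close>, and the integer difference turns into a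
  sum of naturals.\<close>

lemma A_set_rows:
  assumes pos: "\<forall>x\<in>set \<gamma>. 1 \<le> x" and ab: "a < b" "b < length \<gamma>"
  shows "lr_tableaux \<gamma> - A_set (Suc a) (Suc b) t \<gamma> = {T \<in> lr_tableaux \<gamma>. row_list \<gamma> T \<in> movable_rows a b t \<gamma>}"
proof -
  have "T \<in> A_set (Suc a) (Suc b) t \<gamma> \<longleftrightarrow> row_list \<gamma> T \<notin> movable_rows a b t \<gamma>" if T: "T \<in> lr_tableaux \<gamma>" for T
  proof -
    have T': "T \<in> ssyt (ribbon \<gamma>)" using T by (simp add: lr_tableaux_def)
    let ?rs = "row_list \<gamma> T"
    have lr: "?rs \<in> lr_rows \<gamma>"
      using T bij_betw_lr_rows[OF pos] by (auto simp: bij_betw_def)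
    have count: "count_rows T k m = row_count (row_list \<gamma> T) k m" if "k \<le> Suc b" "1 \<le> m" for k m
      using count_rows_row_count[OF T'] that ab by simp
    have "(Suc a \<le> k \<and> k \<le> Suc b - 1 \<and> int (count_rows T k 1) - int (count_rows T (k + 1) 2) < int t) \<longleftrightarrow>
        (a < k \<and> k \<le> b \<and> \<not> t + row_count ?rs (Suc k) 2 \<le> row_count ?rs k 1)" for k
      using count[of k 1] count[of "Suc k" 2] by auto
    then have "T \<in> A_set (Suc a) (Suc b) t \<gamma> \<longleftrightarrow>
        (\<exists>k. a < k \<and> k \<le> b \<and> \<not> t + row_count ?rs (Suc k) 2 \<le> row_count ?rs k 1)"
      using T by (simp only: A_set_def mem_Collect_eq simp_thms)
    then show ?thesis
      using lr by (auto simp: movable_rows_def)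
  qed
  then show ?thesis by (auto simp: A_set_def)
qed

text \<open>Negating the implication in \<open>B_set\<close> leaves the \<open>t\<close> leading
  ones together with the strict inequality towards row \<open>j + 1\<close> whenever that row
  exists.\<close>

lemma B_set_rows:
  assumes pos: "\<forall>x\<in>set \<gamma>. 1 \<le> x" and ab: "a < b" "b < length \<gamma>" and t: "1 \<le> t" "t < \<gamma> ! a"
  shows "lr_tableaux (move_composition a b t \<gamma>) - B_set (Suc a) (Suc b) t \<gamma> =
    {U \<in> lr_tableaux (move_composition a b t \<gamma>).
       row_list (move_composition a b t \<gamma>) U \<in> moved_rows b t (move_composition a b t \<gamma>)}"
proof -
  let ?\<delta> = "move_composition a b t \<gamma>"
  have cells: "move_cells (Suc a) (Suc b) t \<gamma> = ?\<delta>"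
    by (simp add: move_cells_composition)
  have len: "length ?\<delta> = length \<gamma>"
    by (simp add: move_composition_def)
  have pos\<gamma>: "1 \<le> \<gamma> ! k" if "k < length \<gamma>" for k
    using pos that by simp
  have pos\<delta>: "\<forall>x\<in>set ?\<delta>. 1 \<le> x"
    unfolding all_set_conv_all_nth using pos\<gamma> t ab by (auto simp: move_composition_def nth_list_update)
  have \<delta>b: "?\<delta> ! b = \<gamma> ! b + t" "1 \<le> \<gamma> ! b"
    using ab pos\<gamma> by (auto simp: move_composition_def)
  have "U \<in> B_set (Suc a) (Suc b) t \<gamma> \<longleftrightarrow> row_list ?\<delta> U \<notin> moved_rows b t ?\<delta>"
    if U: "U \<in> lr_tableaux ?\<delta>" for U
  proof -
    let ?j = "leftcol ?\<delta> (Suc b)" and ?rs = "row_list ?\<delta> U"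
    have lr: "?rs \<in> lr_rows ?\<delta>"
      using U bij_betw_lr_rows[OF pos\<delta>] by (auto simp: bij_betw_def)
    have nth: "?rs ! b ! l = U (Suc b) (?j + l)" if "l \<le> t" for l
      using nth_row_list_nth[of b ?\<delta> l U] ab \<delta>b that len by simp
    have "length (?rs ! b) = \<gamma> ! b + t"
      using length_nth_row_list[of b ?\<delta> U] ab len \<delta>b by simp
    then have "take t (?rs ! b) = replicate t 1 \<longleftrightarrow> (\<forall>l<t. U (Suc b) (?j + l) = 1)"
      using nth by (simp add: list_eq_iff_nth_eq)
    also have "\<dots> \<longleftrightarrow> (\<forall>c. ?j \<le> c \<and> c \<le> ?j + t - 1 \<longrightarrow> U (Suc b) c = 1)"
    proof (intro iffI allI impI)
      fix c assume "\<forall>l<t. U (Suc b) (?j + l) = 1" "?j \<le> c \<and> c \<le> ?j + t - 1"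
      then show "U (Suc b) c = 1"
        using t(1) by (auto dest: spec[of _ "c - ?j"])
    qed auto
    finally have ones: "take t (?rs ! b) = replicate t 1 \<longleftrightarrow>
       (\<forall>c. ?j \<le> c \<and> c \<le> ?j + t - 1 \<longrightarrow> U (Suc b) c = 1)" .
    have next_row: "last (?rs ! Suc b) = U (Suc (Suc b)) ?j" if "Suc b < length \<gamma>"
      using last_row_list[OF pos\<delta>, of b U] that len by simp
    show ?thesis
      using U lr ones next_row nth[of t] ab unfolding B_set_def cells moved_rows_def Let_def mem_Collect_eq len
      by (auto simp: not_less Suc_le_eq)
  qed
  then show ?thesis
    unfolding cells[symmetric] by (auto simp: B_set_def)
qed

theorem theorem3p4:
  fixes \<alpha> :: "nat list" and i j t :: nat
  assumes "\<forall>a\<in>set \<alpha>. 1 \<le> a"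
    and "\<alpha> \<noteq> replicate (length \<alpha>) 1"
    and "i = (LEAST k. 1 \<le> k \<and> k \<le> length \<alpha> \<and> 2 \<le> part \<alpha> k)"
    and "i < j" and "j \<le> length \<alpha>"
    and "1 \<le> t" and "t \<le> part \<alpha> i - 1"
  shows "ribbon_schur \<alpha> - ribbon_schur (move_cells i j t \<alpha>) =
    (\<Sum>T\<in>A_set i j t \<alpha>. schur (cont T)) - (\<Sum>U\<in>B_set i j t \<alpha>. schur (cont U))"
proof -
  let ?P = "\<lambda>k. 1 \<le> k \<and> k \<le> length \<alpha> \<and> 2 \<le> part \<alpha> k"
  \<comment> \<open>The least index is meaningful only if some part is at least 2; otherwise
    \<alpha> would consist of ones.\<close>
  have "\<exists>k. ?P k"
  proof (rule ccontr)
    assume none: "\<not> (\<exists>k. ?P k)"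
    have "\<alpha> ! k = 1" if "k < length \<alpha>" for k
    proof -
      have "1 \<le> \<alpha> ! k" using assms(1) that by simp
      moreover have "\<not> ?P (Suc k)" using none by blast
      ultimately show ?thesis using that by (simp add: part_def)
    qed
    then show False
      using assms(2) by (auto simp: list_eq_iff_nth_eq)
  qed
  then have i: "?P i"
    unfolding assms(3) by (rule LeastI_ex)
  have minimal: "\<not> ?P k" if "k < i" for k
    using that unfolding assms(3) by (rule not_less_Least)
  define a b where "a = i - 1" and "b = j - 1"
  have ij: "i = Suc a" "j = Suc b" and ab: "a < b" "b < length \<alpha>"
    using i assms(4,5) by (auto simp: a_def b_def)
  have ones: "\<forall>k<a. \<alpha> ! k = 1"
  proof (intro allI impI)
    fix k assume k: "k < a"
    then have "\<not> 2 \<le> \<alpha> ! k"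
      using minimal[of "Suc k"] ij ab by (auto simp: part_def)
    moreover have "1 \<le> \<alpha> ! k" using assms(1) k ab by simp
    ultimately show "\<alpha> ! k = 1" by simp
  qed
  have t: "1 \<le> t" "t < \<alpha> ! a"
    using assms(6,7) by (auto simp: ij part_def)
  let ?\<beta> = "move_composition a b t \<alpha>"
  have \<beta>: "move_cells i j t \<alpha> = ?\<beta>"
    by (simp add: ij move_cells_composition)
  have len: "length ?\<beta> = length \<alpha>"
    by (simp add: move_composition_def)
  have pos\<beta>: "\<forall>x\<in>set ?\<beta>. 1 \<le> x"
    unfolding all_set_conv_all_nth using assms(1) t ab by (auto simp: move_composition_def nth_list_update)
  have ne: "\<alpha> \<noteq> []" "?\<beta> \<noteq> []"
    using ab len by auto
  let ?s = "\<lambda>rs. schur (row_count rs (length \<alpha>))"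
  note bij = bij_betw_lr_rows[OF assms(1)] bij_betw_lr_rows[OF pos\<beta>]
  \<comment> \<open>The terms outside A and outside B agree: the chain passes to lists of rows,
    moves the ones, which keeps the content, and returns to tableaux.\<close>
  have "(\<Sum>T\<in>lr_tableaux \<alpha> - A_set i j t \<alpha>. schur (cont T)) = (\<Sum>rs\<in>movable_rows a b t \<alpha>. ?s rs)"
  proof (rule sum.reindex_cong[of "row_list \<alpha>", symmetric])
    show "inj_on (row_list \<alpha>) (lr_tableaux \<alpha> - A_set i j t \<alpha>)"
      using bij(1) by (auto simp: bij_betw_def intro: inj_on_subset)
    show "movable_rows a b t \<alpha> = row_list \<alpha> ` (lr_tableaux \<alpha> - A_set i j t \<alpha>)"
      unfolding ij A_set_rows[OF assms(1) ab] using bij(1) by (auto simp: bij_betw_def movable_rows_def)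
  qed (use cont_rows[OF assms(1)] in \<open>auto simp: lr_tableaux_def\<close>)
  also have "\<dots> = (\<Sum>rs\<in>movable_rows a b t \<alpha>. ?s (move_ones a b t rs))"
  proof (intro sum.cong refl arg_cong[of _ _ schur] ext)
    fix rs m assume rs: "rs \<in> movable_rows a b t \<alpha>"
    then have "length rs = length \<alpha>"
      by (simp add: movable_rows_def lr_rows_def ribbon_rowsD(1))
    then show "row_count rs (length \<alpha>) m = row_count (move_ones a b t rs) (length \<alpha>) m"
      using row_count_move[OF _ _ _ move_ones_movable(2)[OF assms(1) ab ones t rs], of b "length \<alpha>" m] ab
      by (auto split: if_splits)
  qed
  also have "\<dots> = (\<Sum>rs\<in>moved_rows b t ?\<beta>. ?s rs)"
    by (rule sum.reindex_bij_betw[OF bij_betw_move_ones[OF assms(1) ab ones t]])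
  also have "\<dots> = (\<Sum>U\<in>lr_tableaux ?\<beta> - B_set i j t \<alpha>. schur (cont U))"
  proof (rule sum.reindex_cong[of "row_list ?\<beta>"])
    show "inj_on (row_list ?\<beta>) (lr_tableaux ?\<beta> - B_set i j t \<alpha>)"
      using bij(2) by (auto simp: bij_betw_def intro: inj_on_subset)
    show "moved_rows b t ?\<beta> = row_list ?\<beta> ` (lr_tableaux ?\<beta> - B_set i j t \<alpha>)"
      unfolding ij B_set_rows[OF assms(1) ab t] using bij(2) by (auto simp: bij_betw_def moved_rows_def)
  qed (use cont_rows[OF pos\<beta>] len in \<open>auto simp: lr_tableaux_def\<close>)
  finally have main: "(\<Sum>T\<in>lr_tableaux \<alpha> - A_set i j t \<alpha>. schur (cont T)) =
     (\<Sum>U\<in>lr_tableaux ?\<beta> - B_set i j t \<alpha>. schur (cont U))" .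
  have "ribbon_schur \<alpha> = (\<Sum>T\<in>lr_tableaux \<alpha> - A_set i j t \<alpha>. schur (cont T)) + (\<Sum>T\<in>A_set i j t \<alpha>. schur (cont T))"
    unfolding ribbon_littlewood_richardson[OF assms(1) ne(1)]
    by (rule sum.subset_diff) (auto simp: A_set_def finite_lr_tableaux[OF assms(1)])
  moreover have "ribbon_schur ?\<beta> = (\<Sum>U\<in>lr_tableaux ?\<beta> - B_set i j t \<alpha>. schur (cont U)) + (\<Sum>U\<in>B_set i j t \<alpha>. schur (cont U))"
    unfolding ribbon_littlewood_richardson[OF pos\<beta> ne(2)]
    by (rule sum.subset_diff) (auto simp: B_set_def \<beta> finite_lr_tableaux[OF pos\<beta>])
  ultimately show ?thesis
    unfolding \<beta> main by (simp add: algebra_simps)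
qed

end
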